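(* Let $E,U_0$ be real separable Hilbert spaces, let $C\subset E\times E$ be a possibly multivalued nonlinear $m$-dissipative operator with $\overline{\mathcal D(C)}=E$ and $(0,0)\in C$, and let $F:E\to E$ and $B(x)\in L(U_0,E)$, $x\in E$, satisfy $$\sup_{x\neq y}\frac{\|F(x)-F(y)\|+\|B(x)-B(y)\|_{L(U_0,E)}}{\|x-y\|}<\infty .$$ Let $\alpha>0$ and let $h:E\to\mathbb R$ be bounded and uniformly continuous. Let $\hat H_0,\hat H_1$ be the operators defined from $C,F,B$ in the context. If $\overline f$ is a viscosity subsolution of $(I-\alpha\hat H_0)f=h$ and $\underline f$ is a viscosity supersolution of $(I-\alpha\hat H_1)f=h$ (in the sense defined in the context), then $\overline f\le\underline f$ on $E$.
   Context: $C$ is $m$-dissipative: $\langle x_1-x_2,y_1-y_2\rangle\le0$ for $(x_i,y_i)\in C$, and the range of $I-\alpha C$ is $E$ for all $\alpha>0$. $S(t)$, $t\ge0$, is the strongly continuous contraction semigroup on $E$ generated by $C$: $S(t)x=\lim_{n}(I-\frac tnC)^{-n}x$. $C^0$ is the canonical restriction: for $x\in\mathcal D(C)$, $C^0x$ is the unique element of minimal norm in $\{y:(x,y)\in C\}$. The Tataru distance is $d_C(x,y)=\inf_{t\ge0}\{t+\|x-S(t)y\|\}$. Definition of $\hat H_0$: for $\mu,\rho>0$, $\xi\in\mathcal D(C)$, $y\in E$, put $g(x)=\frac\mu2\|x-\xi\|^2$, $f(x)=g(x)+\rho d_C(x,y)$, and $$\hat H_0f(x)=\mu\langle x-\xi,C^0\xi\rangle+\rho+\sup_{\|q\|\le\rho}\Big(\langle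 F(x),Dg(x)+q\rangle+\tfrac12\|B^*(x)(Dg(x)+q)\|_{U_0}^2\Big).$$ Definition of $\hat H_1$: with $g(x)=-\frac\mu2\|x-\xi\|^2$, $f(x)=g(x)-\rho d_C(x,y)$, $$\hat H_1f(x)=-\mu\langle x-\xi,C^0\xi\rangle-\rho+\inf_{\|q\|\le\rho}\Big(\langle F(x),Dg(x)+q\rangle+\tfrac12\|B^*(x)(Dg(x)+q)\|_{U_0}^2\Big).$$ The domains consist of all such $f$ (over all $\mu,\rho,\xi,y$). $Dg$ is the Fréchet gradient. For a function $g$ on $E$, $g^*(x)=\limsup_{y\to x}g(y)$ and $g_*(x)=\liminf_{y\to x}g(y)$. Viscosity subsolution of $(I-\alpha H)f=h$: a bounded upper semicontinuous $\overline f$ such that whenever $x_0\in E$, $f_0\in\mathcal D(H)$ satisfy $(\overline f-f_0)(x_0)=\sup_{E}(\overline f-f_0)$, one has $\alpha^{-1}(\overline f-h)(x_0)\le(Hf_0)^*(x_0)$. Viscosity supersolution: a bounded lower semicontinuous $\underline f$ such that whenever $(f_0-\underline f)(x_0)=\sup_E(f_0-\underline f)$ with $f_0\in\mathcal D(H)$, one has $\alpha^{-1}(\underline f-h)(x_0)\ge(Hf_0)_*(x_0)$. *)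

theory Defs
  imports "HOL-Analysis.Analysis"
begin

text \<open>
  A possibly multivalued operator is its graph.  This applies both to operators on the Hilbert
  space and to operators on real functions.
\<close>

type_synonym 'a graph = "('a \<times> 'a) set"

definition m_dissipative :: "'e::real_inner graph \<Rightarrow> bool" where
  "m_dissipative C \<longleftrightarrow>
     (\<forall>(x1, y1) \<in> C. \<forall>(x2, y2) \<in> C. inner (x1 - x2) (y1 - y2) \<le> 0) \<and>
     (\<forall>\<alpha>>0. {x - \<alpha> *\<^sub>R y | x y. (x, y) \<in> C} = UNIV)"

text \<open>\<open>resolvent C r\<close> is the map \<open>(I - r C)\<^sup>-\<^sup>1\<close>, which is single-valued
  and everywhere defined if \<open>C\<close> is m-dissipative and \<open>r > 0\<close>.\<close>

definition resolvent :: "'e::real_inner graph \<Rightarrow> real \<Rightarrow> 'e \<Rightarrow> 'e" where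
  "resolvent C r z = (THE x. \<exists>y. (x, y) \<in> C \<and> x - r *\<^sub>R y = z)"

text \<open>The case \<open>t = 0\<close> is separate because \<open>(I - 0 C)\<^sup>-\<^sup>1\<close> is the identity on the
  domain of \<open>C\<close> only.\<close>

definition semigroup :: "'e::real_inner graph \<Rightarrow> real \<Rightarrow> 'e \<Rightarrow> 'e" where
  "semigroup C t x = (if t = 0 then x else lim (\<lambda>n. (resolvent C (t / real n) ^^ n) x))"

definition canonical_restriction :: "'e::real_inner graph \<Rightarrow> 'e \<Rightarrow> 'e" where
  "canonical_restriction C x = (THE y. is_arg_min norm (\<lambda>z. (x, z) \<in> C) y)"

definition tataru_dist :: "'e::real_inner graph \<Rightarrow> 'e \<Rightarrow> 'e \<Rightarrow> real" where
  "tataru_dist C x y = (INF t\<in>{0..}. t + norm (x - semigroup C t y))"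

definition grad :: "('e::real_inner \<Rightarrow> real) \<Rightarrow> 'e \<Rightarrow> 'e" where
  "grad g x = (THE D. GDERIV g x :> D)"

definition hamiltonian ::
    "('e::real_inner \<Rightarrow> 'e) \<Rightarrow> ('e \<Rightarrow> 'u::real_inner \<Rightarrow>\<^sub>L 'e) \<Rightarrow> 'e \<Rightarrow> 'e \<Rightarrow> real" where
  "hamiltonian F B x p = inner (F x) p + 1/2 * (norm (adjoint (blinfun_apply (B x)) p))\<^sup>2"

definition H0 ::
    "'e::real_inner graph \<Rightarrow> ('e \<Rightarrow> 'e) \<Rightarrow> ('e \<Rightarrow> 'u::real_inner \<Rightarrow>\<^sub>L 'e) \<Rightarrow> ('e \<Rightarrow> real) graph" where
  "H0 C F B =
     {(\<lambda>x. g x + \<rho> * tataru_dist C x y,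
       \<lambda>x. \<mu> * inner (x - \<xi>) (canonical_restriction C \<xi>) + \<rho>
             + (SUP q\<in>cball 0 \<rho>. hamiltonian F B x (grad g x + q)))
      | g \<mu> \<rho> \<xi> y. \<mu> > 0 \<and> \<rho> > 0 \<and> \<xi> \<in> Domain C \<and> g = (\<lambda>x. \<mu> / 2 * (norm (x - \<xi>))\<^sup>2)}"

definition H1 ::
    "'e::real_inner graph \<Rightarrow> ('e \<Rightarrow> 'e) \<Rightarrow> ('e \<Rightarrow> 'u::real_inner \<Rightarrow>\<^sub>L 'e) \<Rightarrow> ('e \<Rightarrow> real) graph" where
  "H1 C F B =
     {(\<lambda>x. g x - \<rho> * tataru_dist C x y,
       \<lambda>x. - \<mu> * inner (x - \<xi>) (canonical_restriction C \<xi>) - \<rho>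
             + (INF q\<in>cball 0 \<rho>. hamiltonian F B x (grad g x + q)))
      | g \<mu> \<rho> \<xi> y. \<mu> > 0 \<and> \<rho> > 0 \<and> \<xi> \<in> Domain C \<and> g = (\<lambda>x. - \<mu> / 2 * (norm (x - \<xi>))\<^sup>2)}"

text \<open>The filter \<open>nhds x\<close> includes the point \<open>x\<close> itself, so that these are the
  upper and lower semicontinuous envelopes.  A priori they may be infinite.\<close>

definition upper_env :: "('e::topological_space \<Rightarrow> real) \<Rightarrow> 'e \<Rightarrow> ereal" where
  "upper_env g x = Limsup (nhds x) (\<lambda>y. ereal (g y))"

definition lower_env :: "('e::topological_space \<Rightarrow> real) \<Rightarrow> 'e \<Rightarrow> ereal" where
  "lower_env g x = Liminf (nhds x) (\<lambda>y. ereal (g y))"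

definition upper_semicontinuous :: "('e::topological_space \<Rightarrow> real) \<Rightarrow> bool" where
  "upper_semicontinuous f \<longleftrightarrow> (\<forall>x. upper_env f x \<le> ereal (f x))"

definition lower_semicontinuous :: "('e::topological_space \<Rightarrow> real) \<Rightarrow> bool" where
  "lower_semicontinuous f \<longleftrightarrow> (\<forall>x. ereal (f x) \<le> lower_env f x)"

text \<open>Sub- and supersolutions of \<open>(I - \<alpha>H)f = h\<close>.  That a supremum over the whole space is
  attained at \<open>x0\<close> is spelled out, because the real-valued \<open>Sup\<close> is
  unspecified on sets that are not bounded above.\<close>

definition viscosity_subsolution ::
    "('e::topological_space \<Rightarrow> real) graph \<Rightarrow> real \<Rightarrow> ('e \<Rightarrow> real) \<Rightarrow> ('e \<Rightarrow> real) \<Rightarrow> bool" where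
  "viscosity_subsolution H \<alpha> h f \<longleftrightarrow>
     bounded (range f) \<and> upper_semicontinuous f \<and>
     (\<forall>(f0, Hf0) \<in> H. \<forall>x0. (\<forall>x. f x - f0 x \<le> f x0 - f0 x0) \<longrightarrow>
        ereal (inverse \<alpha> * (f x0 - h x0)) \<le> upper_env Hf0 x0)"

definition viscosity_supersolution ::
    "('e::topological_space \<Rightarrow> real) graph \<Rightarrow> real \<Rightarrow> ('e \<Rightarrow> real) \<Rightarrow> ('e \<Rightarrow> real) \<Rightarrow> bool" where
  "viscosity_supersolution H \<alpha> h f \<longleftrightarrow>
     bounded (range f) \<and> lower_semicontinuous f \<and>
     (\<forall>(f0, Hf0) \<in> H. \<forall>x0. (\<forall>x. f0 x - f x \<le> f0 x0 - f x0) \<longrightarrow>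
        ereal (inverse \<alpha> * (f x0 - h x0)) \<ge> lower_env Hf0 x0)"

end

theory Submission
  imports Defs
begin

text \<open>
  The proof doubles the variables.  If the claim failed, \<open>\<theta> fsub x - fsuper y\<close> would be positive
  somewhere on the diagonal for some \<open>\<theta> > 1\<close>, and one would like to maximise it minus a quadratic
  penalty \<open>b/2 \<parallel>x - y\<parallel>\<^sup>2\<close> and subtract the two viscosity inequalities.  Three obstacles have to be
  overcome.

  Maxima need not exist in infinite dimensions.  They are produced by Ekeland's variational principle
  with respect to the Tataru distance (\<open>ekeland\<close>), which is why the test functions contain
  that distance.  It requires the triangle inequality and completeness
  (\<open>tataru_dist_triangle\<close>, \<open>tataru_dist_forward_Cauchy\<close>), and hence convergence of the exponential
  formula, the semigroup law and strong continuity.  The convergence comes from the quadratic estimate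
  \<open>resolvent_power_difference\<close> for powers of resolvents.

  The quadratic in a test function must be centred in the domain of \<open>C\<close>, whereas \<open>y\<close> is
  arbitrary, and \<open>C\<^sup>0\<close> is not continuous.  So two further variables \<open>\<xi>\<close> and \<open>\<eta>\<close> in the domain are
  inserted between \<open>x\<close> and \<open>y\<close> (\<open>quadrupled\<close>).  The unbounded contributions to the viscosity inequalities
  are \<open>b \<langle>x - \<xi>, C\<^sup>0 \<xi>\<rangle>\<close> and \<open>b \<langle>y - \<eta>, C\<^sup>0 \<eta>\<rangle>\<close>.  Optimality of \<open>\<xi>\<close> and \<open>\<eta>\<close> along the flow of
  \<open>C\<close> allows replacing \<open>x - \<xi>\<close> by \<open>\<xi> - \<eta>\<close> and \<open>y - \<eta>\<close> by \<open>\<eta> - \<xi>\<close>, and then the sum is nonpositive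
  because \<open>C\<close> is dissipative (\<open>canonical_drift_le\<close>).  Here \<open>\<xi>\<close> and \<open>\<eta>\<close> are only nearly optimal, and
  the derivative along the flow has to be controlled uniformly.  For this the maximisation is done over
  pairs in \<open>C\<close> with a small penalty on the value component, and the competitor is a resolvent step
  (\<open>near_optimal_canonical\<close>).

  The Hamiltonian is quadratic in the momentum, so Lipschitz continuity of \<open>B\<close> does not
  make the difference of the Hamiltonians small.  The factor \<open>\<theta> > 1\<close> makes the
  quadratic term of the subsolution smaller than that of the supersolution, and this absorbs the
  critical mixed term (\<open>hamiltonian_gap\<close>).

  All remaining errors are bounded by the penalties, which are of order \<open>\<delta>\<close> at the points
  in question for a suitable \<open>b\<close> (\<open>near_maximizers\<close>, \<open>doubling_error\<close>); \<open>\<delta>\<close> is chosen after \<open>\<theta>\<close>.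
\<close>

section \<open>Minimal norm and adjoints in Hilbert spaces\<close>

lemma parallelogram_midpoint:
  fixes a b :: "'e::real_inner"
  shows "(norm (a - b))\<^sup>2 = 2 * (norm a)\<^sup>2 + 2 * (norm b)\<^sup>2 - 4 * (norm ((1/2) *\<^sub>R (a + b)))\<^sup>2"
  by (simp add: power2_norm_eq_inner algebra_simps inner_commute)

lemma midpoint_in_convex:
  assumes "convex A" "a \<in> A" "b \<in> A"
  shows "(1/2) *\<^sub>R (a + b) \<in> A"
  using convexD[OF assms, of "1/2" "1/2"] by (simp add: scaleR_add_right)

text \<open>A minimising sequence is Cauchy by the parallelogram identity, because midpoints stay in the
  convex set and hence cannot have norm below the infimum.\<close>

lemma ex_min_norm:
  fixes A :: "'e::{real_inner, complete_space} set"
  assumes "closed A" "convex A" "A \<noteq> {}"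
  shows "\<exists>a\<in>A. \<forall>x\<in>A. norm a \<le> norm x"
proof -
  define d where "d = (INF x\<in>A. (norm x)\<^sup>2)"
  have bdd: "bdd_below ((\<lambda>x. (norm x)\<^sup>2) ` A)"
    by (rule bdd_belowI2[of _ 0]) simp
  have d_le: "d \<le> (norm x)\<^sup>2" if "x \<in> A" for x
    unfolding d_def using bdd that by (rule cINF_lower)
  have "\<exists>x\<in>A. (norm x)\<^sup>2 < d + 1 / Suc n" for n
    using cINF_less_iff[OF assms(3) bdd, of "d + 1 / Suc n"] by (simp add: d_def)
  then obtain s where sA: "s n \<in> A" and s: "(norm (s n))\<^sup>2 < d + 1 / Suc n" for n
    by metis
  have dist_s: "(norm (s m - s n))\<^sup>2 \<le> 2 / Suc m + 2 / Suc n" for m n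
  proof -
    define q where "q = (norm ((1/2) *\<^sub>R (s m + s n)))\<^sup>2"
    have "d \<le> q"
      unfolding q_def using d_le midpoint_in_convex[OF assms(2) sA sA] by blast
    moreover have "(norm (s m - s n))\<^sup>2 = 2 * (norm (s m))\<^sup>2 + 2 * (norm (s n))\<^sup>2 - 4 * q"
      unfolding q_def by (rule parallelogram_midpoint)
    ultimately show ?thesis using s[of m] s[of n] by argo
  qed
  have "Cauchy s"
  proof (rule metric_CauchyI)
    fix e :: real assume e: "e > 0"
    obtain N where N: "4 / e\<^sup>2 < real N" using reals_Archimedean2 by blast
    have "dist (s m) (s n) < e" if "m \<ge> N" "n \<ge> N" for m n
    proof -
      have "N > 0" using N e by (cases N) (auto simp: field_simps)
      have "2 / Suc m + 2 / Suc n < 2 / real N + 2 / real N"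
        using that \<open>N > 0\<close> by (intro add_strict_mono) (auto simp: field_simps)
      also have "\<dots> = 4 / real N" by simp
      also have "\<dots> < e\<^sup>2" using N e \<open>N > 0\<close> by (simp add: field_simps)
      finally have "(norm (s m - s n))\<^sup>2 < e\<^sup>2" using dist_s[of m n] by linarith
      then show ?thesis using e by (simp add: dist_norm power_less_imp_less_base)
    qed
    then show "\<exists>M. \<forall>m\<ge>M. \<forall>n\<ge>M. dist (s m) (s n) < e" by blast
  qed
  then obtain a where a: "s \<longlonglongrightarrow> a" using Cauchy_convergent_iff convergent_def by blast
  have "a \<in> A" using closed_sequentially[OF assms(1)] sA a by blast
  have "(\<lambda>n. (norm (s n))\<^sup>2) \<longlonglongrightarrow> (norm a)\<^sup>2"
    by (intro tendsto_intros a)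
  moreover have "(\<lambda>n. d + 1 / Suc n) \<longlonglongrightarrow> d"
    using tendsto_add[OF tendsto_const LIMSEQ_inverse_real_of_nat, of d]
    by (simp add: inverse_eq_divide)
  ultimately have "(norm a)\<^sup>2 \<le> d"
    by (rule LIMSEQ_le) (use s in \<open>auto intro!: exI[of _ 0] less_imp_le\<close>)
  then have "norm a \<le> norm x" if "x \<in> A" for x
    using d_le[OF that] by (meson norm_ge_zero order_trans power2_le_imp_le)
  then show ?thesis using \<open>a \<in> A\<close> by blast
qed

lemma min_norm_unique:
  fixes A :: "'e::real_inner set"
  assumes "convex A" "a \<in> A" "\<forall>x\<in>A. norm a \<le> norm x" "b \<in> A" "\<forall>x\<in>A. norm b \<le> norm x"
  shows "a = b"
proof -
  have "norm a = norm b" using assms by (meson order_antisym)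
  moreover have "norm a \<le> norm ((1/2) *\<^sub>R (a + b))"
    using assms midpoint_in_convex by blast
  then have "(norm a)\<^sup>2 \<le> (norm ((1/2) *\<^sub>R (a + b)))\<^sup>2" by (simp add: power_mono)
  ultimately have "(norm (a - b))\<^sup>2 \<le> 0"
    using parallelogram_midpoint[of a b] by simp
  then show ?thesis by simp
qed

text \<open>The Riesz vector is a multiple of the minimal-norm element \<open>a\<close> of the affine
  hyperplane \<open>{x. f x = 1}\<close>; minimality makes \<open>a\<close> orthogonal to the kernel of \<open>f\<close>.\<close>

lemma riesz_representation:
  fixes f :: "'e::{real_inner, complete_space} \<Rightarrow> real"
  assumes f: "bounded_linear f"
  shows "\<exists>a. \<forall>x. f x = inner x a"
proof (cases "\<exists>x. f x \<noteq> 0")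
  case False
  then show ?thesis by (intro exI[of _ 0]) simp
next
  case True
  interpret bounded_linear f by (rule f)
  from True obtain x0 where x0: "f x0 \<noteq> 0" by blast
  let ?A = "{x. f x = 1}"
  have "closed ?A"
    by (intro closed_Collect_eq continuous_intros linear_continuous_on f)
  moreover have "convex ?A"
    by (rule convexI) (simp add: add scaleR)
  moreover have "inverse (f x0) *\<^sub>R x0 \<in> ?A" using x0 by (simp add: scaleR)
  then have "?A \<noteq> {}" by blast
  ultimately obtain a where fa: "f a = 1" and a: "\<forall>x. f x = 1 \<longrightarrow> norm a \<le> norm x"
    using ex_min_norm[of ?A] by auto
  have "a \<noteq> 0" using fa zero by auto
  have orth: "inner n a = 0" if n: "f n = 0" for n
  proof (cases "n = 0")
    case False
    define t where "t = inner n a / (norm n)\<^sup>2"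
    have "f (a - t *\<^sub>R n) = 1" by (simp add: diff scaleR fa n)
    then have "(norm a)\<^sup>2 \<le> (norm (a - t *\<^sub>R n))\<^sup>2"
      using a by (simp add: power_mono)
    also have "\<dots> = (norm a)\<^sup>2 - 2 * t * inner n a + t\<^sup>2 * (norm n)\<^sup>2"
      by (simp add: power2_norm_eq_inner inner_diff_left inner_diff_right inner_commute)
         (simp add: power2_eq_square)
    also have "\<dots> = (norm a)\<^sup>2 - (inner n a)\<^sup>2 / (norm n)\<^sup>2"
      using False by (simp add: t_def field_simps power2_eq_square)
    finally have "(inner n a)\<^sup>2 / (norm n)\<^sup>2 \<le> 0" by simp
    then show ?thesis using False by (simp add: divide_le_0_iff)
  qed simp
  have "f x = inner x ((1 / (norm a)\<^sup>2) *\<^sub>R a)" for x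
  proof -
    have "f (x - f x *\<^sub>R a) = 0" by (simp add: diff scaleR fa)
    then have "inner (x - f x *\<^sub>R a) a = 0" by (rule orth)
    then have "inner x a = f x * (norm a)\<^sup>2"
      by (simp add: inner_diff_left power2_norm_eq_inner)
    then show ?thesis using \<open>a \<noteq> 0\<close> by simp
  qed
  then show ?thesis by blast
qed

text \<open>The constant \<open>adjoint\<close> is a choice among all functions that satisfy the adjoint
  equation, so everything about it rests on the existence of one such function.  Here that is the
  Riesz theorem in the possibly infinite-dimensional domain.\<close>

lemma inner_adjoint:
  fixes T :: "'u::{real_inner, complete_space} \<Rightarrow>\<^sub>L 'e::real_inner"
  shows "inner x (adjoint (blinfun_apply T) p) = inner (blinfun_apply T x) p"
proof -
  have "\<forall>p. \<exists>a. \<forall>x. inner (blinfun_apply T x) p = inner x a"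
  proof
    fix p :: 'e
    have "bounded_linear (\<lambda>x. inner (blinfun_apply T x) p)"
      by (intro bounded_linear_inner_left_comp blinfun.bounded_linear_right)
    then show "\<exists>a. \<forall>x. inner (blinfun_apply T x) p = inner x a"
      by (rule riesz_representation)
  qed
  then have "\<exists>f'. \<forall>x y. inner (blinfun_apply T x) y = inner x (f' y)" by metis
  then have "\<forall>x y. inner (blinfun_apply T x) y = inner x (adjoint (blinfun_apply T) y)"
    unfolding adjoint_def by (rule someI_ex)
  then show ?thesis by simp
qed

lemma vector_eq_inner:
  fixes a b :: "'e::real_inner"
  assumes "\<And>x. inner x a = inner x b"
  shows "a = b"
proof -
  have "inner (a - b) (a - b) = 0" using assms[of "a - b"] by (simp add: inner_diff_right)
  then show ?thesis by simp
qed

context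
  fixes T :: "'u::{real_inner, complete_space} \<Rightarrow>\<^sub>L 'e::real_inner"
begin

lemma adjoint_add: "adjoint (blinfun_apply T) (p + q) = adjoint (blinfun_apply T) p + adjoint (blinfun_apply T) q"
  by (rule vector_eq_inner) (simp add: inner_adjoint inner_add_right)

lemma adjoint_scale: "adjoint (blinfun_apply T) (r *\<^sub>R p) = r *\<^sub>R adjoint (blinfun_apply T) p"
  by (rule vector_eq_inner) (simp add: inner_adjoint)

text \<open>The usual self-improving argument: test the adjoint equation with \<open>T\<^sup>* p\<close> itself and
  divide by its norm.\<close>

lemma norm_adjoint_le: "norm (adjoint (blinfun_apply T) p) \<le> norm T * norm p"
proof -
  let ?a = "adjoint (blinfun_apply T) p"
  have "(norm ?a)\<^sup>2 = inner (blinfun_apply T ?a) p"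
    by (simp add: power2_norm_eq_inner inner_adjoint)
  also have "\<dots> \<le> norm (blinfun_apply T ?a) * norm p" by (rule norm_cauchy_schwarz)
  also have "\<dots> \<le> norm T * norm ?a * norm p"
    by (intro mult_right_mono norm_blinfun) simp
  finally have "norm ?a * norm ?a \<le> norm ?a * (norm T * norm p)"
    by (simp add: power2_eq_square algebra_simps)
  then show ?thesis by (cases "norm ?a = 0") (auto simp: mult_le_cancel_left)
qed

end

text \<open>\<open>S\<^sup>* p - T\<^sup>* q = S\<^sup>* (p - q) + (S - T)\<^sup>* q\<close>.\<close>

lemma norm_adjoint_diff_le:
  fixes S T :: "'u::{real_inner, complete_space} \<Rightarrow>\<^sub>L 'e::real_inner"
  shows "norm (adjoint (blinfun_apply S) p - adjoint (blinfun_apply T) q)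
           \<le> norm S * norm (p - q) + norm (S - T) * norm q"
proof -
  have "adjoint (blinfun_apply S) p - adjoint (blinfun_apply T) q
      = adjoint (blinfun_apply S) (p - q) + adjoint (blinfun_apply (S - T)) q"
    by (rule vector_eq_inner)
       (simp add: inner_adjoint inner_diff_left inner_diff_right inner_add_right blinfun.diff_left)
  then show ?thesis
    using norm_triangle_le add_mono[OF norm_adjoint_le norm_adjoint_le] by metis
qed

section \<open>Resolvents and the canonical restriction of an m-dissipative operator\<close>

definition yosida :: "'e::real_inner graph \<Rightarrow> real \<Rightarrow> 'e \<Rightarrow> 'e" where
  "yosida C r x = (1 / r) *\<^sub>R (resolvent C r x - x)"

context
  fixes C :: "'e::real_inner graph"
  assumes C: "m_dissipative C"
begin

lemma dissipative:
  "(x1, y1) \<in> C \<Longrightarrow> (x2, y2) \<in> C \<Longrightarrow> inner (x1 - x2) (y1 - y2) \<le> 0"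
  using C unfolding m_dissipative_def by blast

lemma dissipative_unique:
  assumes "(x1, y1) \<in> C" "(x2, y2) \<in> C" "r > 0" "x1 - r *\<^sub>R y1 = x2 - r *\<^sub>R y2"
  shows "x1 = x2"
proof -
  have "x1 - x2 = r *\<^sub>R (y1 - y2)" using assms(4) by (simp add: algebra_simps)
  then have "inner (x1 - x2) (x1 - x2) = r * inner (x1 - x2) (y1 - y2)"
    by (metis inner_scaleR_right)
  also have "\<dots> \<le> 0" using dissipative[OF assms(1,2)] \<open>r > 0\<close> by (simp add: mult_le_0_iff)
  finally show ?thesis by (metis eq_iff_diff_eq_0 inner_gt_zero_iff not_le)
qed

lemma resolvent_ex:
  assumes r: "r > 0"
  shows "\<exists>y. (resolvent C r z, y) \<in> C \<and> resolvent C r z - r *\<^sub>R y = z"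
proof -
  have "z \<in> {x - r *\<^sub>R y | x y. (x, y) \<in> C}"
    using C r unfolding m_dissipative_def by blast
  then obtain x y where "(x, y) \<in> C" "x - r *\<^sub>R y = z" by blast
  then have "\<exists>!x. \<exists>y. (x, y) \<in> C \<and> x - r *\<^sub>R y = z"
    using dissipative_unique[OF _ _ r] by (metis (no_types, lifting))
  then show ?thesis unfolding resolvent_def by (rule theI')
qed

lemma yosida_in:
  assumes r: "r > 0"
  shows "(resolvent C r z, yosida C r z) \<in> C"
proof -
  obtain y where y: "(resolvent C r z, y) \<in> C" "resolvent C r z - r *\<^sub>R y = z"
    using resolvent_ex[OF r] by blast
  have "resolvent C r z - z = r *\<^sub>R y" using y(2) by (simp add: algebra_simps)
  then have "yosida C r z = y" using r by (simp add: yosida_def)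
  then show ?thesis using y by simp
qed

lemma resolvent_eq: "r > 0 \<Longrightarrow> resolvent C r z = z + r *\<^sub>R yosida C r z"
  by (simp add: yosida_def)

text \<open>The difference \<open>d\<close> of two resolvents is \<open>x - y\<close> plus \<open>r\<close> times a difference of values of
  \<open>C\<close>, and the latter has nonpositive inner product with \<open>d\<close>.\<close>

lemma resolvent_nonexpansive:
  assumes r: "r > 0"
  shows "norm (resolvent C r x - resolvent C r y) \<le> norm (x - y)"
proof -
  let ?d = "resolvent C r x - resolvent C r y" and ?w = "yosida C r x - yosida C r y"
  have "inner ?d ?w \<le> 0" using dissipative yosida_in[OF r] by blast
  moreover have "?d = (x - y) + r *\<^sub>R ?w"
    using resolvent_eq[OF r] by (simp add: algebra_simps)
  then have "(norm ?d)\<^sup>2 = inner ?d (x - y) + r * inner ?d ?w"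
    by (metis inner_add_right inner_scaleR_right power2_norm_eq_inner)
  ultimately have "(norm ?d)\<^sup>2 \<le> inner ?d (x - y)"
    using r by (simp add: mult_le_0_iff)
  also have "\<dots> \<le> norm ?d * norm (x - y)" by (rule norm_cauchy_schwarz)
  finally have "norm ?d * norm ?d \<le> norm ?d * norm (x - y)" by (simp add: power2_eq_square)
  then show ?thesis by (cases "norm ?d = 0") (auto simp: mult_le_cancel_left)
qed

text \<open>Testing dissipativity of \<open>C\<close> with \<open>(x, w)\<close> and the Yosida pair gives
  \<open>\<parallel>A\<parallel>\<^sup>2 \<le> \<langle>A, w\<rangle>\<close> for the Yosida approximation \<open>A\<close> of \<open>C\<close> at \<open>x\<close>, which contains both
  bounds.\<close>

lemma
  assumes r: "r > 0" and xw: "(x, w) \<in> C"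
  shows norm_yosida_le: "norm (yosida C r x) \<le> norm w"
    and norm_yosida_diff: "(norm (yosida C r x - w))\<^sup>2 \<le> (norm w)\<^sup>2 - (norm (yosida C r x))\<^sup>2"
proof -
  let ?A = "yosida C r x"
  have "inner (resolvent C r x - x) (?A - w) \<le> 0"
    using dissipative yosida_in[OF r] xw by blast
  then have "r * inner ?A (?A - w) \<le> 0" using resolvent_eq[OF r, of x] by simp
  then have le: "(norm ?A)\<^sup>2 \<le> inner ?A w"
    using r by (simp add: inner_diff_right power2_norm_eq_inner mult_le_0_iff)
  also have "\<dots> \<le> norm ?A * norm w" by (rule norm_cauchy_schwarz)
  finally have "norm ?A * norm ?A \<le> norm ?A * norm w" by (simp add: power2_eq_square)
  then show "norm ?A \<le> norm w" by (cases "norm ?A = 0") (auto simp: mult_le_cancel_left)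
  have "(norm (?A - w))\<^sup>2 = (norm ?A)\<^sup>2 - 2 * inner ?A w + (norm w)\<^sup>2"
    by (simp add: power2_norm_eq_inner algebra_simps inner_commute)
  then show "(norm (?A - w))\<^sup>2 \<le> (norm w)\<^sup>2 - (norm ?A)\<^sup>2" using le by linarith
qed

text \<open>An m-dissipative operator is maximal: a pair that is dissipative against all of \<open>C\<close> is
  compared with the element of \<open>C\<close> that solves the same resolvent equation.  Its values are
  therefore intersections of closed half-spaces.\<close>

lemma maximal_iff:
  "(x, y) \<in> C \<longleftrightarrow> (\<forall>(x', y') \<in> C. inner (x - x') (y - y') \<le> 0)"
proof
  assume max: "\<forall>(x', y') \<in> C. inner (x - x') (y - y') \<le> 0"
  obtain y' where y': "(resolvent C 1 (x - y), y') \<in> C" "resolvent C 1 (x - y) - y' = x - y"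
    using resolvent_ex[of 1 "x - y"] by auto
  define x' where "x' = resolvent C 1 (x - y)"
  have "x - x' = y - y'" using y'(2) by (simp add: x'_def algebra_simps)
  moreover have "inner (x - x') (y - y') \<le> 0" using max y'(1) by (auto simp: x'_def)
  ultimately have "inner (x - x') (x - x') \<le> 0" by simp
  then have "x - x' = 0" by (metis inner_gt_zero_iff not_le)
  then show "(x, y) \<in> C" using y' \<open>x - x' = y - y'\<close> by (simp add: x'_def)
qed (use dissipative in auto)

lemma values_closed_convex: "closed {y. (x, y) \<in> C}" "convex {y. (x, y) \<in> C}"
proof -
  have eq: "{y. (x, y) \<in> C} = (\<Inter>(x', y')\<in>C. {y. inner (x - x') y \<le> inner (x - x') y'})"
    by (subst maximal_iff) (auto simp: inner_diff_right)
  show "closed {y. (x, y) \<in> C}"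
    unfolding eq by (auto intro!: closed_INT closed_Collect_le continuous_intros)
  show "convex {y. (x, y) \<in> C}"
    unfolding eq by (auto intro!: convex_INT convex_halfspace_le)
qed

end

lemma
  fixes C :: "'e::{real_inner, complete_space} graph"
  assumes C: "m_dissipative C" and x: "x \<in> Domain C"
  shows canonical_restriction_in: "(x, canonical_restriction C x) \<in> C"
    and canonical_restriction_min: "(x, w) \<in> C \<Longrightarrow> norm (canonical_restriction C x) \<le> norm w"
proof -
  let ?A = "{y. (x, y) \<in> C}"
  let ?P = "is_arg_min norm (\<lambda>z. (x, z) \<in> C)"
  have P: "?P y \<longleftrightarrow> y \<in> ?A \<and> (\<forall>z\<in>?A. norm y \<le> norm z)" for y
    by (auto simp: is_arg_min_def not_less)
  have "\<exists>y. ?P y"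
    using ex_min_norm[OF values_closed_convex[OF C]] x by (auto simp: P)
  moreover have "y = z" if "?P y" "?P z" for y z
    using that min_norm_unique[OF values_closed_convex(2)[OF C]] unfolding P by blast
  ultimately have "\<exists>!y. ?P y" by blast
  then have "?P (canonical_restriction C x)"
    unfolding canonical_restriction_def by (rule theI')
  then show "(x, canonical_restriction C x) \<in> C"
    and "(x, w) \<in> C \<Longrightarrow> norm (canonical_restriction C x) \<le> norm w"
    unfolding P by auto
qed

section \<open>Convergence of the exponential formula\<close>

lemma dense_approx:
  fixes C :: "'e::real_inner graph"
  assumes dense: "closure (Domain C) = UNIV" and "e > 0"
  obtains x' w' where "(x', w') \<in> C" "norm (x - x') < e"
proof -
  have "x \<in> closure (Domain C)" using dense by simp
  then obtain x' where "x' \<in> Domain C" "dist x' x < e"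
    using assms unfolding closure_approachable by blast
  then show thesis using that by (auto simp: dist_norm norm_minus_commute)
qed

context
  fixes C :: "'e::real_inner graph"
  assumes C: "m_dissipative C"
begin

lemma resolvent_power_nonexpansive:
  assumes "r > 0"
  shows "norm ((resolvent C r ^^ i) x - (resolvent C r ^^ i) y) \<le> norm (x - y)"
proof (induction i)
  case (Suc i)
  then show ?case using resolvent_nonexpansive[OF C assms] order_trans by (simp, blast)
qed simp

text \<open>Each further step moves the point by at most the first step, because resolvents are
  nonexpansive, and the first step is bounded through any value of \<open>C\<close> at \<open>x\<close>.\<close>

lemma resolvent_power_displacement:
  assumes r: "r > 0" and xw: "(x, w) \<in> C"
  shows "norm ((resolvent C r ^^ i) x - x) \<le> real i * r * norm w"
proof (induction i)
  case (Suc i)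
  let ?J = "resolvent C r" and ?y = "(resolvent C r ^^ i) x"
  have "norm (?J ?y - x) \<le> norm (?J ?y - ?J x) + norm (?J x - x)"
    using norm_triangle_ineq[of "?J ?y - ?J x" "?J x - x"] by simp
  also have "norm (?J ?y - ?J x) \<le> real i * r * norm w"
    using resolvent_nonexpansive[OF C r] Suc order_trans by blast
  also have "norm (?J x - x) \<le> r * norm w"
    using resolvent_eq[OF C r, of x] norm_yosida_le[OF C r xw] r by simp
  finally show ?case by (simp add: algebra_simps)
qed simp

text \<open>With \<open>a\<close> and \<open>b\<close> the two resolvents and \<open>A\<close>, \<open>B\<close> the corresponding values of \<open>C\<close>, the vector
  \<open>(l + m) (a - b)\<close> equals \<open>m (x - b) + l (a - y) + l m (A - B)\<close>.  The last term pairs nonpositively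
  with \<open>a - b\<close>; Young's inequality handles the other two.  The points compared on the
  right have taken one step less on one of the two sides, which prepares a double induction.\<close>

lemma resolvent_cross_estimate:
  assumes l: "l > 0" and m: "m > 0"
  shows "(l + m) * (norm (resolvent C l x - resolvent C m y))\<^sup>2
    \<le> m * (norm (x - resolvent C m y))\<^sup>2 + l * (norm (resolvent C l x - y))\<^sup>2"
proof -
  define a b where "a = resolvent C l x" and "b = resolvent C m y"
  let ?A = "yosida C l x" and ?B = "yosida C m y"
  have ax: "a - x = l *\<^sub>R ?A" and bY: "b - y = m *\<^sub>R ?B"
    using resolvent_eq[OF C l, of x] resolvent_eq[OF C m, of y] by (simp_all add: a_def b_def)
  have "inner (a - b) (?A - ?B) \<le> 0"
    unfolding a_def b_def using dissipative[OF C] yosida_in[OF C] l m by blast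
  then have "(l * m) * inner (a - b) (?A - ?B) \<le> 0" using l m by (simp add: mult_le_0_iff)
  also have "(l * m) * inner (a - b) (?A - ?B) = inner (a - b) (m *\<^sub>R (a - x) - l *\<^sub>R (b - y))"
    unfolding ax bY by (simp add: inner_diff_right algebra_simps)
  also have "m *\<^sub>R (a - x) - l *\<^sub>R (b - y) = (l + m) *\<^sub>R (a - b) - m *\<^sub>R (x - b) - l *\<^sub>R (a - y)"
    by (simp add: algebra_simps)
  finally have *: "(l + m) * (norm (a - b))\<^sup>2 \<le> m * inner (a - b) (x - b) + l * inner (a - b) (a - y)"
    by (simp add: inner_diff_right power2_norm_eq_inner algebra_simps)
  have young: "2 * inner u v \<le> (norm u)\<^sup>2 + (norm v)\<^sup>2" for u v :: 'e
    using zero_le_power2[of "norm (u - v)"]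
    by (simp add: power2_norm_eq_inner inner_diff_left inner_diff_right inner_commute)
  have "2 * (m * inner (a - b) (x - b)) \<le> m * ((norm (a - b))\<^sup>2 + (norm (x - b))\<^sup>2)"
    using mult_left_mono[OF young, of m "a - b" "x - b"] m by simp
  moreover have "2 * (l * inner (a - b) (a - y)) \<le> l * ((norm (a - b))\<^sup>2 + (norm (a - y))\<^sup>2)"
    using mult_left_mono[OF young, of l "a - b" "a - y"] l by simp
  ultimately have "(l + m) * (norm (a - b))\<^sup>2 \<le> m * (norm (x - b))\<^sup>2 + l * (norm (a - y))\<^sup>2"
    using * by (simp add: distrib_right distrib_left)
  then show ?thesis unfolding a_def b_def .
qed

text \<open>The Crandall-Liggett estimate in Kobayashi's form.  The expression on the right is the exact
  solution of the recursion \<open>(l + m) R (i + 1) (j + 1) = m R i (j + 1) + l R (i + 1) j\<close> that comes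
  from the one-step estimate, so the double induction loses nothing, and it dominates
  the displacement bounds that hold for \<open>i = 0\<close> and for \<open>j = 0\<close>.\<close>

lemma resolvent_power_difference:
  assumes l: "l > 0" and m: "m > 0" and xw: "(x, w) \<in> C"
  shows "(norm ((resolvent C l ^^ i) x - (resolvent C m ^^ j) x))\<^sup>2
    \<le> (norm w)\<^sup>2 * ((real i * l - real j * m)\<^sup>2 + real i * l\<^sup>2 + real j * m\<^sup>2)"
proof (induction i arbitrary: j)
  case 0
  have "(norm (x - (resolvent C m ^^ j) x))\<^sup>2 \<le> (real j * m * norm w)\<^sup>2"
    using resolvent_power_displacement[OF m xw, of j] by (simp add: norm_minus_commute power_mono)
  also have "\<dots> \<le> (norm w)\<^sup>2 * ((real j * m)\<^sup>2 + real j * m\<^sup>2)"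
    by (simp add: algebra_simps)
  finally show ?case by simp
next
  case (Suc i)
  note IHi = Suc.IH
  show ?case
  proof (induction j)
    case 0
    have "(norm ((resolvent C l ^^ Suc i) x - x))\<^sup>2 \<le> (real (Suc i) * l * norm w)\<^sup>2"
      using resolvent_power_displacement[OF l xw, of "Suc i"] by (intro power_mono) auto
    also have "\<dots> \<le> (norm w)\<^sup>2 * ((real (Suc i) * l)\<^sup>2 + real (Suc i) * l\<^sup>2)"
      by (simp only: power_mult_distrib) (simp add: algebra_simps)
    finally show ?case by simp
  next
    case (Suc j)
    define X Y where "X = (resolvent C l ^^ i) x" and "Y = (resolvent C m ^^ j) x"
    define K where "K = (norm w)\<^sup>2"
    have "(l + m) * (norm (resolvent C l X - resolvent C m Y))\<^sup>2
        \<le> m * (norm (X - resolvent C m Y))\<^sup>2 + l * (norm (resolvent C l X - Y))\<^sup>2"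
      by (rule resolvent_cross_estimate[OF l m])
    also have "\<dots> \<le> m * (K * ((real i * l - real (Suc j) * m)\<^sup>2 + real i * l\<^sup>2 + real (Suc j) * m\<^sup>2))
        + l * (K * ((real (Suc i) * l - real j * m)\<^sup>2 + real (Suc i) * l\<^sup>2 + real j * m\<^sup>2))"
      using IHi[of "Suc j"] Suc l m
      by (intro add_mono mult_left_mono) (auto simp: X_def Y_def K_def)
    also have "\<dots> = (l + m) * (K * ((real (Suc i) * l - real (Suc j) * m)\<^sup>2
                        + real (Suc i) * l\<^sup>2 + real (Suc j) * m\<^sup>2))"
      by (simp add: algebra_simps power2_eq_square)
    finally show ?case using l m by (simp add: X_def Y_def K_def)
  qed
qed

context
  assumes dense: "closure (Domain C) = UNIV"
begin

text \<open>On the domain of \<open>C\<close> this is the quantitative estimate; equicontinuity (all powers of resolvents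
  are nonexpansive) carries it to the closure.\<close>

lemma resolvent_power_same_limit:
  assumes l: "\<And>n. l n > 0" "l \<longlonglongrightarrow> 0" "(\<lambda>n. real (i n) * l n) \<longlonglongrightarrow> t"
    and m: "\<And>n. m n > 0" "m \<longlonglongrightarrow> 0" "(\<lambda>n. real (j n) * m n) \<longlonglongrightarrow> t"
  shows "(\<lambda>n. norm ((resolvent C (l n) ^^ i n) x - (resolvent C (m n) ^^ j n) x)) \<longlonglongrightarrow> 0"
proof (rule tendstoI)
  fix e :: real assume "e > 0"
  then obtain x' w where xw: "(x', w) \<in> C" and near: "norm (x - x') < e / 3"
    using dense_approx[OF dense, of "e / 3" x] by auto
  let ?D = "\<lambda>n z. norm ((resolvent C (l n) ^^ i n) z - (resolvent C (m n) ^^ j n) z)"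
  let ?R = "\<lambda>n. (norm w)\<^sup>2 * ((real (i n) * l n - real (j n) * m n)\<^sup>2
                    + (real (i n) * l n) * l n + (real (j n) * m n) * m n)"
  have "?R \<longlonglongrightarrow> (norm w)\<^sup>2 * ((t - t)\<^sup>2 + t * 0 + t * 0)"
    by (intro tendsto_intros l m)
  then have "?R \<longlonglongrightarrow> 0" by simp
  moreover have "0 < (e / 3)\<^sup>2" using \<open>e > 0\<close> by simp
  ultimately have "\<forall>\<^sub>F n in sequentially. ?R n < (e / 3)\<^sup>2"
    by (rule order_tendstoD)
  then show "\<forall>\<^sub>F n in sequentially. dist (?D n x) 0 < e"
  proof eventually_elim
    case (elim n)
    have "(?D n x')\<^sup>2 \<le> ?R n"
      using resolvent_power_difference[OF l(1)[of n] m(1)[of n] xw, of "i n" "j n"]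
      by (simp add: power2_eq_square mult.assoc)
    then have "?D n x' < e / 3"
      using elim \<open>e > 0\<close> by (meson le_less_trans less_imp_le power_less_imp_less_base
          zero_le_divide_iff zero_le_numeral)
    moreover have "?D n x \<le> norm ((resolvent C (l n) ^^ i n) x - (resolvent C (l n) ^^ i n) x')
        + ?D n x' + norm ((resolvent C (m n) ^^ j n) x' - (resolvent C (m n) ^^ j n) x)"
      by norm
    ultimately show ?case
      using resolvent_power_nonexpansive[OF l(1)[of n], of "i n" x x']
        resolvent_power_nonexpansive[OF m(1)[of n], of "j n" x' x] near
      by (simp add: norm_minus_commute)
  qed
qed

end

end

section \<open>The contraction semigroup\<close>

context
  fixes C :: "'e::{real_inner, complete_space} graph"
  assumes C: "m_dissipative C" and dense: "closure (Domain C) = UNIV"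
begin

text \<open>If the sequence were not Cauchy, two sequences of indices would witness this.  Both define
  step sizes tending to \<open>0\<close> whose total length is \<open>t\<close>, which the previous lemma excludes.\<close>

lemma exponential_formula:
  assumes t: "t > 0"
  shows "(\<lambda>n. (resolvent C (t / real n) ^^ n) x) \<longlonglongrightarrow> semigroup C t x"
proof -
  let ?s = "\<lambda>n. (resolvent C (t / real n) ^^ n) x"
  have "Cauchy ?s"
  proof (rule ccontr)
    assume "\<not> Cauchy ?s"
    then obtain e where e: "e > 0" and "\<forall>N. \<exists>p q. p \<ge> N \<and> q \<ge> N \<and> \<not> dist (?s p) (?s q) < e"
      unfolding Cauchy_def by blast
    \<comment> \<open>Indices from \<open>Suc N\<close> on, so that no step size is a division by zero.\<close>
    then have "\<forall>N. \<exists>p q. p \<ge> Suc N \<and> q \<ge> Suc N \<and> \<not> dist (?s p) (?s q) < e" by blast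
    then obtain p q where p: "\<And>N. p N \<ge> Suc N" and q: "\<And>N. q N \<ge> Suc N"
      and far: "\<And>N. \<not> dist (?s (p N)) (?s (q N)) < e" by metis
    have step: "\<And>N. t / real (k N) > 0" "(\<lambda>N. t / real (k N)) \<longlonglongrightarrow> 0"
      "(\<lambda>N. real (k N) * (t / real (k N))) \<longlonglongrightarrow> t" if k: "\<And>N. k N \<ge> Suc N" for k :: "nat \<Rightarrow> nat"
    proof -
      have pos: "k N > 0" for N using k[of N] by simp
      show "\<And>N. t / real (k N) > 0" using pos t by simp
      have "filterlim k at_top sequentially"
        by (rule filterlim_at_top_mono[OF filterlim_Suc]) (use k in auto)
      then have "filterlim (\<lambda>N. real (k N)) at_top sequentially"
        by (rule filterlim_compose[OF filterlim_real_sequentially])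
      then show "(\<lambda>N. t / real (k N)) \<longlonglongrightarrow> 0"
        by (intro real_tendsto_divide_at_top[OF tendsto_const])
      show "(\<lambda>N. real (k N) * (t / real (k N))) \<longlonglongrightarrow> t" using pos by simp
    qed
    have "(\<lambda>N. norm (?s (p N) - ?s (q N))) \<longlonglongrightarrow> 0"
      by (rule resolvent_power_same_limit[OF C dense step[OF p] step[OF q]])
    then have "\<forall>\<^sub>F N in sequentially. norm (?s (p N) - ?s (q N)) < e"
      using e by (rule order_tendstoD)
    then show False using far by (auto simp: dist_norm eventually_sequentially)
  qed
  then show ?thesis
    using t by (simp add: semigroup_def Cauchy_convergent_iff convergent_LIMSEQ_iff)
qed

text \<open>The freedom to choose step sizes and numbers of steps is what makes the semigroup law pass
  to the limit: different times can be approximated with the same step size.\<close>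

lemma semigroup_LIMSEQ:
  assumes t: "t \<ge> 0"
    and l: "\<And>n. l n > 0" "l \<longlonglongrightarrow> 0" "(\<lambda>n. real (i n) * l n) \<longlonglongrightarrow> t"
  shows "(\<lambda>n. (resolvent C (l n) ^^ i n) x) \<longlonglongrightarrow> semigroup C t x"
proof (cases "t = 0")
  case True
  have "(\<lambda>n. norm ((resolvent C (l n) ^^ i n) x - (resolvent C (l n) ^^ 0) x)) \<longlonglongrightarrow> 0"
    by (rule resolvent_power_same_limit[OF C dense l l(1,2)]) (simp add: True)
  then show ?thesis using True LIM_zero_cancel[of _ x] by (simp add: semigroup_def tendsto_norm_zero_iff)
next
  case False
  then have t: "t > 0" using t by simp
  have lim: "(\<lambda>n. (resolvent C (t / real (Suc n)) ^^ Suc n) x) \<longlonglongrightarrow> semigroup C t x"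
    using exponential_formula[OF t, THEN LIMSEQ_Suc] .
  have "(\<lambda>n. norm ((resolvent C (l n) ^^ i n) x - (resolvent C (t / real (Suc n)) ^^ Suc n) x)) \<longlonglongrightarrow> 0"
  proof (rule resolvent_power_same_limit[OF C dense l])
    show "(\<lambda>n. t / real (Suc n)) \<longlonglongrightarrow> 0"
      by (rule LIMSEQ_Suc[OF lim_const_over_n])
  qed (use t in auto)
  from tendsto_add[OF this[unfolded tendsto_norm_zero_iff] lim] show ?thesis by simp
qed

text \<open>A step size that works for all times at once.\<close>

lemma floor_step_LIMSEQ:
  assumes "t \<ge> 0"
  shows "(\<lambda>n. real (nat \<lfloor>t * real (Suc n)\<rfloor>) * (1 / real (Suc n))) \<longlonglongrightarrow> t"
proof (rule tendsto_sandwich)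
  have *: "real (nat \<lfloor>t * real (Suc n)\<rfloor>) = of_int \<lfloor>t * real (Suc n)\<rfloor>" for n
    using assms by simp
  show "\<forall>\<^sub>F n in sequentially. t - 1 / real (Suc n) \<le> real (nat \<lfloor>t * real (Suc n)\<rfloor>) * (1 / real (Suc n))"
  proof (rule always_eventually, rule allI)
    fix n
    have "t * real (Suc n) - 1 \<le> of_int \<lfloor>t * real (Suc n)\<rfloor>" by linarith
    then show "t - 1 / real (Suc n) \<le> real (nat \<lfloor>t * real (Suc n)\<rfloor>) * (1 / real (Suc n))"
      using divide_right_mono[of "t * real (Suc n) - 1" _ "real (Suc n)"]
      unfolding * by (simp add: diff_divide_distrib del: of_nat_Suc)
  qed
  show "\<forall>\<^sub>F n in sequentially. real (nat \<lfloor>t * real (Suc n)\<rfloor>) * (1 / real (Suc n)) \<le> t"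
  proof (rule always_eventually, rule allI)
    fix n
    have "of_int \<lfloor>t * real (Suc n)\<rfloor> \<le> t * real (Suc n)" by linarith
    then show "real (nat \<lfloor>t * real (Suc n)\<rfloor>) * (1 / real (Suc n)) \<le> t"
      unfolding * by (simp add: field_simps)
  qed
  have "(\<lambda>n. 1 / real (Suc n)) \<longlonglongrightarrow> 0" by (rule LIMSEQ_Suc[OF lim_1_over_n])
  from tendsto_diff[OF tendsto_const this] show "(\<lambda>n. t - 1 / real (Suc n)) \<longlonglongrightarrow> t" by simp
qed simp

lemma semigroup_floor_LIMSEQ:
  assumes "t \<ge> 0"
  shows "(\<lambda>n. (resolvent C (1 / real (Suc n)) ^^ nat \<lfloor>t * real (Suc n)\<rfloor>) x) \<longlonglongrightarrow> semigroup C t x"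
  by (rule semigroup_LIMSEQ[OF assms _ LIMSEQ_Suc[OF lim_1_over_n] floor_step_LIMSEQ[OF assms]]) simp

lemma semigroup_nonexpansive:
  assumes "t \<ge> 0"
  shows "norm (semigroup C t x - semigroup C t y) \<le> norm (x - y)"
proof (rule Lim_bounded)
  let ?J = "\<lambda>n. resolvent C (1 / real (Suc n)) ^^ nat \<lfloor>t * real (Suc n)\<rfloor>"
  show "(\<lambda>n. norm (?J n x - ?J n y)) \<longlonglongrightarrow> norm (semigroup C t x - semigroup C t y)"
    by (intro tendsto_intros semigroup_floor_LIMSEQ assms)
  show "\<forall>n\<ge>0. norm (?J n x - ?J n y) \<le> norm (x - y)"
    using resolvent_power_nonexpansive[OF C] by simp
qed

lemma semigroup_displacement:
  assumes "t \<ge> 0" "(x, w) \<in> C"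
  shows "norm (semigroup C t x - x) \<le> t * norm w"
proof (rule LIMSEQ_le)
  let ?J = "\<lambda>n. resolvent C (1 / real (Suc n)) ^^ nat \<lfloor>t * real (Suc n)\<rfloor>"
  show "(\<lambda>n. norm (?J n x - x)) \<longlonglongrightarrow> norm (semigroup C t x - x)"
    by (intro tendsto_intros semigroup_floor_LIMSEQ assms)
  show "(\<lambda>n. real (nat \<lfloor>t * real (Suc n)\<rfloor>) * (1 / real (Suc n)) * norm w) \<longlonglongrightarrow> t * norm w"
    by (intro tendsto_intros floor_step_LIMSEQ assms)
  show "\<exists>N. \<forall>n\<ge>N. norm (?J n x - x) \<le> real (nat \<lfloor>t * real (Suc n)\<rfloor>) * (1 / real (Suc n)) * norm w"
    using resolvent_power_displacement[OF C _ assms(2)] by (metis of_nat_0_less_iff zero_less_Suc zero_less_divide_1_iff)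
qed

text \<open>With the step size \<open>1 / Suc n\<close> common to all times, the discrete law is additivity of exponents;
  nonexpansiveness allows replacing the inner approximation by its limit.\<close>

lemma semigroup_add:
  assumes s: "s \<ge> 0" and t: "t \<ge> 0"
  shows "semigroup C (s + t) x = semigroup C s (semigroup C t x)"
proof (rule LIMSEQ_unique)
  let ?r = "\<lambda>n. 1 / real (Suc n)"
  let ?k = "\<lambda>t n. nat \<lfloor>t * real (Suc n)\<rfloor>"
  let ?J = "\<lambda>t n. resolvent C (?r n) ^^ ?k t n"
  have "(\<lambda>n. real (?k s n) * ?r n + real (?k t n) * ?r n) \<longlonglongrightarrow> s + t"
    by (intro tendsto_add floor_step_LIMSEQ s t)
  then have k: "(\<lambda>n. real (?k s n + ?k t n) * ?r n) \<longlonglongrightarrow> s + t"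
    by (simp add: distrib_right add_divide_distrib)
  have "(\<lambda>n. (resolvent C (?r n) ^^ (?k s n + ?k t n)) x) \<longlonglongrightarrow> semigroup C (s + t) x"
    by (rule semigroup_LIMSEQ[OF add_nonneg_nonneg[OF s t] _ LIMSEQ_Suc[OF lim_1_over_n] k]) simp
  then show "(\<lambda>n. ?J s n (?J t n x)) \<longlonglongrightarrow> semigroup C (s + t) x"
    by (simp add: funpow_add)
  have "(\<lambda>n. ?J s n (?J t n x) - ?J s n (semigroup C t x)) \<longlonglongrightarrow> 0"
  proof (rule Lim_null_comparison)
    show "\<forall>\<^sub>F n in sequentially. norm (?J s n (?J t n x) - ?J s n (semigroup C t x))
        \<le> norm (?J t n x - semigroup C t x)"
      by (intro always_eventually allI resolvent_power_nonexpansive[OF C]) simp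
    show "(\<lambda>n. norm (?J t n x - semigroup C t x)) \<longlonglongrightarrow> 0"
      using LIM_zero[OF semigroup_floor_LIMSEQ[OF t]] by (simp add: tendsto_norm_zero_iff)
  qed
  from tendsto_add[OF this semigroup_floor_LIMSEQ[OF s, of "semigroup C t x"]]
  show "(\<lambda>n. ?J s n (?J t n x)) \<longlonglongrightarrow> semigroup C s (semigroup C t x)" by simp
qed

lemma semigroup_continuous_0:
  assumes "e > 0"
  obtains d where "d > 0" "\<And>t. 0 \<le> t \<Longrightarrow> t < d \<Longrightarrow> norm (semigroup C t x - x) < e"
proof -
  obtain x' w where xw: "(x', w) \<in> C" and near: "norm (x - x') < e / 3"
    using dense_approx[OF dense, of "e / 3" x] assms by auto
  define d where "d = e / (3 * (norm w + 1))"
  have pos: "norm w + 1 > 0" by (simp add: add_nonneg_pos)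
  have "norm (semigroup C t x - x) < e" if t: "0 \<le> t" "t < d" for t
  proof -
    have "t * (norm w + 1) < e / 3" using t(2) pos by (simp add: d_def field_simps)
    then have "t * norm w < e / 3" using t(1) by (simp add: distrib_left)
    then have "norm (semigroup C t x' - x') < e / 3"
      using semigroup_displacement[OF t(1) xw] by simp
    moreover have "norm (semigroup C t x - semigroup C t x') < e / 3"
      using semigroup_nonexpansive[OF t(1)] near le_less_trans by blast
    moreover have "norm (semigroup C t x - x) \<le> norm (semigroup C t x - semigroup C t x')
        + norm (semigroup C t x' - x') + norm (x' - x)"
      by norm
    ultimately show ?thesis using near by (simp add: norm_minus_commute)
  qed
  then show thesis using that[of d] assms pos by (simp add: d_def)
qed

end

section \<open>The Tataru distance and Ekeland's principle\<close>

context
  fixes C :: "'e::{real_inner, complete_space} graph"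
begin

lemma tataru_bdd: "bdd_below ((\<lambda>t. t + norm (x - semigroup C t y)) ` {0..})"
  by (rule bdd_belowI2[of _ 0]) simp

lemma tataru_dist_nonneg: "0 \<le> tataru_dist C x y"
  unfolding tataru_dist_def by (rule cINF_greatest) auto

lemma tataru_dist_le: "t \<ge> 0 \<Longrightarrow> tataru_dist C x y \<le> t + norm (x - semigroup C t y)"
  unfolding tataru_dist_def by (rule cINF_lower[OF tataru_bdd]) simp

lemma tataru_dist_refl: "tataru_dist C x x = 0"
  using tataru_dist_le[of 0 x x] tataru_dist_nonneg[of x x] by (simp add: semigroup_def)

lemma tataru_dist_less:
  assumes "tataru_dist C x y < r"
  obtains t where "t \<ge> 0" "t + norm (x - semigroup C t y) < r"
  using assms cINF_less_iff[OF _ tataru_bdd] unfolding tataru_dist_def by fastforce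

text \<open>An infimum of functions with Lipschitz constant \<open>1\<close>.  Since the distance vanishes on the diagonal,
  it is also dominated by the norm distance.\<close>

lemma tataru_dist_lipschitz: "tataru_dist C x z \<le> tataru_dist C y z + norm (x - y)"
proof (rule field_le_epsilon)
  fix e :: real assume "e > 0"
  then obtain t where t: "t \<ge> 0" "t + norm (y - semigroup C t z) < tataru_dist C y z + e"
    using tataru_dist_less[of y z "tataru_dist C y z + e"] by auto
  have "norm (x - semigroup C t z) \<le> norm (y - semigroup C t z) + norm (x - y)" by norm
  then show "tataru_dist C x z \<le> tataru_dist C y z + norm (x - y) + e"
    using tataru_dist_le[OF t(1), of x z] t(2) by linarith
qed

context
  assumes C: "m_dissipative C" and dense: "closure (Domain C) = UNIV"
begin

text \<open>Concatenate the two times: \<open>S (t + s) z = S t (S s z)\<close>, and \<open>S t\<close> is a contraction.\<close>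

lemma tataru_dist_triangle: "tataru_dist C x z \<le> tataru_dist C x y + tataru_dist C y z"
proof (rule field_le_epsilon)
  fix e :: real assume e: "e > 0"
  obtain t where t: "t \<ge> 0" "t + norm (x - semigroup C t y) < tataru_dist C x y + e / 2"
    using tataru_dist_less[of x y "tataru_dist C x y + e / 2"] e by auto
  obtain s where s: "s \<ge> 0" "s + norm (y - semigroup C s z) < tataru_dist C y z + e / 2"
    using tataru_dist_less[of y z "tataru_dist C y z + e / 2"] e by auto
  have "norm (x - semigroup C (t + s) z)
      \<le> norm (x - semigroup C t y) + norm (semigroup C t y - semigroup C t (semigroup C s z))"
    unfolding semigroup_add[OF C dense t(1) s(1)] by norm
  also have "\<dots> \<le> norm (x - semigroup C t y) + norm (y - semigroup C s z)"
    using semigroup_nonexpansive[OF C dense t(1)] by simp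
  finally show "tataru_dist C x z \<le> tataru_dist C x y + tataru_dist C y z + e"
    using tataru_dist_le[of "t + s" x z] t s by linarith
qed

text \<open>Completeness with respect to the nonsymmetric distance.  For late indices \<open>k < m\<close>, the point
  \<open>z m\<close> is close to \<open>S s (z k)\<close> and \<open>z k\<close> is close to \<open>S t (z n)\<close>, with \<open>n\<close> fixed.  The remaining
  difference of \<open>S s (S t (z n))\<close> and \<open>S t (z n)\<close> is at most that of \<open>S s (z n)\<close> and \<open>z n\<close>, which
  is small because \<open>s\<close> is small and \<open>n\<close> stays fixed.\<close>

lemma tataru_dist_forward_Cauchy:
  assumes z: "\<And>e. e > 0 \<Longrightarrow> \<exists>N. \<forall>n\<ge>N. \<forall>m\<ge>n. tataru_dist C (z m) (z n) < e"
  shows "convergent z"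
proof -
  let ?S = "semigroup C"
  have "Cauchy z"
  proof (rule CauchyI')
    fix e :: real assume e: "e > 0"
    obtain n where n: "\<And>m. m \<ge> n \<Longrightarrow> tataru_dist C (z m) (z n) < e / 4"
      using z[of "e / 4"] e by (auto dest: spec[of _ n for n])
    obtain d where d: "d > 0" "\<And>s. 0 \<le> s \<Longrightarrow> s < d \<Longrightarrow> norm (?S s (z n) - z n) < e / 4"
      using semigroup_continuous_0[OF C dense, of "e / 4" "z n"] e by auto
    obtain N where N: "\<And>k m. k \<ge> N \<Longrightarrow> m \<ge> k \<Longrightarrow> tataru_dist C (z m) (z k) < min d (e / 4)"
      using z[of "min d (e / 4)"] e d(1) by auto
    have "dist (z k) (z m) < e" if k: "k \<ge> max n N" and m: "m > k" for k m
    proof -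
      obtain t where t: "t \<ge> 0" "t + norm (z k - ?S t (z n)) < e / 4"
        using n[of k] k tataru_dist_less by (metis max.boundedE)
      obtain s where s: "s \<ge> 0" "s + norm (z m - ?S s (z k)) < min d (e / 4)"
        using N[of k m] k m tataru_dist_less by (metis max.boundedE less_imp_le)
      have "norm (?S s (z k) - ?S s (?S t (z n))) \<le> norm (z k - ?S t (z n))"
        by (rule semigroup_nonexpansive[OF C dense s(1)])
      moreover have "?S s (?S t (z n)) = ?S t (?S s (z n))"
        using semigroup_add[OF C dense s(1) t(1)] semigroup_add[OF C dense t(1) s(1)]
        by (metis add.commute)
      then have "norm (?S s (?S t (z n)) - ?S t (z n)) \<le> norm (?S s (z n) - z n)"
        using semigroup_nonexpansive[OF C dense t(1)] by metis
      moreover have "s < d" using s norm_ge_zero[of "z m - ?S s (z k)"] by linarith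
      then have "norm (?S s (z n) - z n) < e / 4" using d(2) s(1) by blast
      moreover have "norm (z m - z k) \<le> norm (z m - ?S s (z k))
          + norm (?S s (z k) - ?S s (?S t (z n)))
          + norm (?S s (?S t (z n)) - ?S t (z n)) + norm (z k - ?S t (z n))"
        by norm
      ultimately show ?thesis using t s by (simp add: dist_norm norm_minus_commute)
    qed
    then show "\<exists>M. \<forall>m\<ge>M. \<forall>n>m. dist (z m) (z n) < e"
      by (intro exI[of _ "max n N"]) simp
  qed
  then show ?thesis by (simp add: Cauchy_convergent_iff)
qed

end

end

text \<open>Ekeland's variational principle for a nonsymmetric distance.  Let \<open>S z\<close> be the set of points
  that beat \<open>z\<close> by \<open>\<rho>\<close> times their distance from \<open>z\<close>; membership in it is transitive by the
  triangle inequality.  A sequence that nearly maximises \<open>\<psi>\<close> over \<open>S\<close> of its predecessor is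
  forward Cauchy since \<open>\<psi>\<close> increases along it, and nothing can beat its limit.\<close>

lemma ekeland:
  fixes \<psi> :: "'a::metric_space \<Rightarrow> real" and D :: "'a \<Rightarrow> 'a \<Rightarrow> real"
  assumes usc: "\<And>x e. e > 0 \<Longrightarrow> \<forall>\<^sub>F y in nhds x. \<psi> y < \<psi> x + e"
    and bdd: "\<And>x. \<psi> x \<le> K"
    and D_nonneg: "\<And>x y. 0 \<le> D x y" and D_refl: "\<And>x. D x x = 0"
    and D_triangle: "\<And>x y z. D x z \<le> D x y + D y z"
    and D_lipschitz: "\<And>x y z. D x z \<le> D y z + dist x y"
    and complete: "\<And>z. (\<And>e. e > 0 \<Longrightarrow> \<exists>N. \<forall>n\<ge>N. \<forall>m\<ge>n. D (z m) (z n) < e) \<Longrightarrow> convergent z"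
    and \<rho>: "\<rho> > 0"
  obtains x1 where "\<psi> x0 \<le> \<psi> x1" "\<And>x. \<psi> x - \<rho> * D x x1 \<le> \<psi> x1"
proof -
  define S where "S z = {x. \<psi> z + \<rho> * D x z \<le> \<psi> x}" for z
  have S_refl: "z \<in> S z" for z by (simp add: S_def D_refl)
  have S_trans: "x \<in> S y \<Longrightarrow> y \<in> S z \<Longrightarrow> x \<in> S z" for x y z
    using mult_left_mono[OF D_triangle[of x z y], of \<rho>] \<rho> by (simp add: S_def distrib_left)
  have S_le: "\<psi> z \<le> \<psi> x" if "x \<in> S z" for x z
    using that mult_nonneg_nonneg[OF less_imp_le[OF \<rho>] D_nonneg[of x z]] by (simp add: S_def)
  have bdd_S: "bdd_above (\<psi> ` S z)" for z by (rule bdd_aboveI2) (rule bdd)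
  have "\<exists>y\<in>S z. \<forall>x\<in>S z. \<psi> x < \<psi> y + 1 / Suc n" for z and n :: nat
  proof -
    have "(SUP x\<in>S z. \<psi> x) - 1 / Suc n < (SUP x\<in>S z. \<psi> x)" by simp
    then obtain y where "y \<in> S z" "(SUP x\<in>S z. \<psi> x) - 1 / Suc n < \<psi> y"
      using less_cSUP_iff[OF _ bdd_S, of z] S_refl[of z] by blast
    moreover have "\<psi> x \<le> (SUP x\<in>S z. \<psi> x)" if "x \<in> S z" for x
      using that bdd_S by (rule cSUP_upper)
    ultimately show ?thesis by (intro bexI[of _ y]) (auto simp: algebra_simps intro: le_less_trans)
  qed
  then have "\<forall>n z. \<exists>y. y \<in> S z \<and> (\<forall>x\<in>S z. \<psi> x < \<psi> y + 1 / Suc n)" by blast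
  then obtain pick where "\<forall>n z. pick n z \<in> S z \<and> (\<forall>x\<in>S z. \<psi> x < \<psi> (pick n z) + 1 / Suc n)"
    unfolding choice_iff by blast
  then have pick: "pick n z \<in> S z" "\<And>x. x \<in> S z \<Longrightarrow> \<psi> x < \<psi> (pick n z) + 1 / Suc n" for n z
    by auto
  define s where "s = rec_nat x0 pick"
  have s_0: "s 0 = x0" and s_Suc: "s (Suc n) = pick n (s n)" for n by (simp_all add: s_def)
  have chain: "s m \<in> S (s n)" if "m \<ge> n" for m n
    using that by (induction rule: dec_induct) (auto simp: S_refl s_Suc intro: S_trans pick)
  have "incseq (\<lambda>n. \<psi> (s n))"
    by (rule incseq_SucI) (simp add: s_Suc S_le pick)
  then obtain l where l: "(\<lambda>n. \<psi> (s n)) \<longlonglongrightarrow> l" and le_l: "\<And>n. \<psi> (s n) \<le> l"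
    using incseq_convergent[of "\<lambda>n. \<psi> (s n)" K] bdd by auto
  have D_le: "\<rho> * D (s m) (s n) \<le> \<psi> (s m) - \<psi> (s n)" if "m \<ge> n" for m n
    using chain[OF that] by (simp add: S_def)
  have "convergent s"
  proof (rule complete)
    fix e :: real assume e: "e > 0"
    have "\<forall>\<^sub>F n in sequentially. l - \<rho> * e < \<psi> (s n)"
      using l by (rule order_tendstoD) (use e \<rho> in simp)
    then obtain N where N: "\<And>n. n \<ge> N \<Longrightarrow> l - \<rho> * e < \<psi> (s n)"
      by (auto simp: eventually_sequentially)
    have "D (s m) (s n) < e" if "n \<ge> N" "m \<ge> n" for m n
    proof -
      have "\<rho> * D (s m) (s n) < \<rho> * e" using D_le[OF that(2)] N[OF that(1)] le_l[of m] by linarith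
      then show ?thesis using \<rho> by simp
    qed
    then show "\<exists>N. \<forall>n\<ge>N. \<forall>m\<ge>n. D (s m) (s n) < e" by blast
  qed
  then obtain x1 where x1: "s \<longlonglongrightarrow> x1" unfolding convergent_def by blast
  have l_le: "l \<le> \<psi> x1"
  proof (rule field_le_epsilon)
    fix e :: real assume "e > 0"
    then have "\<forall>\<^sub>F n in sequentially. \<psi> (s n) < \<psi> x1 + e"
      using usc[of e x1] x1 unfolding filterlim_iff by blast
    then have "\<forall>\<^sub>F n in sequentially. \<psi> (s n) \<le> \<psi> x1 + e" by (rule eventually_mono) simp
    then show "l \<le> \<psi> x1 + e" by (intro tendsto_upperbound[OF l]) auto
  qed
  have x1_S: "x1 \<in> S (s n)" for n
  proof -
    have "\<rho> * D x1 (s n) \<le> l - \<psi> (s n) + \<rho> * dist x1 (s m)" if "m \<ge> n" for m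
      using mult_left_mono[OF D_lipschitz[of x1 "s n" "s m"], of \<rho>] D_le[OF that] le_l[of m] \<rho>
      by (simp add: distrib_left)
    moreover have "(\<lambda>m. l - \<psi> (s n) + \<rho> * dist x1 (s m)) \<longlonglongrightarrow> l - \<psi> (s n) + \<rho> * dist x1 x1"
      by (intro tendsto_intros x1)
    ultimately have "\<rho> * D x1 (s n) \<le> l - \<psi> (s n) + \<rho> * dist x1 x1"
      by (intro LIMSEQ_le_const) auto
    then show ?thesis using l_le by (simp add: S_def)
  qed
  have "\<psi> x - \<rho> * D x x1 \<le> \<psi> x1" for x
  proof (rule ccontr)
    assume far: "\<not> ?thesis"
    then have x: "x \<in> S x1" by (simp add: S_def)
    have "\<psi> x \<le> \<psi> x1 + 1 / Suc n" for n
    proof -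
      have "\<psi> x < \<psi> (s (Suc n)) + 1 / Suc n" using pick(2)[OF S_trans[OF x x1_S]] by (simp add: s_Suc)
      also have "\<dots> \<le> \<psi> x1 + 1 / Suc n" using le_l[of "Suc n"] l_le by simp
      finally show ?thesis by simp
    qed
    moreover have "(\<lambda>n. \<psi> x1 + 1 / Suc n) \<longlonglongrightarrow> \<psi> x1"
      using tendsto_add[OF tendsto_const LIMSEQ_Suc[OF lim_1_over_n], of "\<psi> x1"] by simp
    ultimately have "\<psi> x \<le> \<psi> x1" by (intro LIMSEQ_le_const) auto
    then show False
      using far mult_nonneg_nonneg[OF less_imp_le[OF \<rho>] D_nonneg[of x x1]] by linarith
  qed
  moreover have "\<psi> x0 \<le> \<psi> x1" using S_le[OF x1_S[of 0]] by (simp add: s_0)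
  ultimately show thesis using that by blast
qed

section \<open>Viscosity inequalities at perturbed maximum points\<close>

lemma isCont_nhds: "isCont f x \<Longrightarrow> (f \<longlongrightarrow> f x) (nhds x)"
  by (simp add: isCont_def tendsto_at_iff_tendsto_nhds)

text \<open>A continuous majorant removes the semicontinuous envelope from the viscosity inequality.\<close>

lemma upper_env_bound:
  assumes "ereal a \<le> upper_env g x" "\<And>y. g y \<le> G y" "isCont G x"
  shows "a \<le> G x"
proof -
  have "((\<lambda>y. ereal (G y)) \<longlongrightarrow> ereal (G x)) (nhds x)"
    by (rule tendsto_ereal[OF isCont_nhds[OF assms(3)]])
  then have "Limsup (nhds x) (\<lambda>y. ereal (G y)) = ereal (G x)"
    by (intro lim_imp_Limsup) simp_all
  moreover have "upper_env g x \<le> Limsup (nhds x) (\<lambda>y. ereal (G y))"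
    unfolding upper_env_def by (intro Limsup_mono always_eventually allI) (simp add: assms(2))
  ultimately have "ereal a \<le> ereal (G x)" using assms(1) order_trans by metis
  then show ?thesis by simp
qed

lemma lower_env_bound:
  assumes "lower_env g x \<le> ereal a" "\<And>y. G y \<le> g y" "isCont G x"
  shows "G x \<le> a"
proof -
  have "((\<lambda>y. ereal (G y)) \<longlongrightarrow> ereal (G x)) (nhds x)"
    by (rule tendsto_ereal[OF isCont_nhds[OF assms(3)]])
  then have "Liminf (nhds x) (\<lambda>y. ereal (G y)) = ereal (G x)"
    by (intro lim_imp_Liminf) simp_all
  moreover have "Liminf (nhds x) (\<lambda>y. ereal (G y)) \<le> lower_env g x"
    unfolding lower_env_def by (intro Liminf_mono always_eventually allI) (simp add: assms(2))
  ultimately have "ereal (G x) \<le> ereal a" using assms(1) order_trans by metis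
  then show ?thesis by simp
qed

lemma upper_semicontinuousD:
  assumes "upper_semicontinuous f" "e > 0"
  shows "\<forall>\<^sub>F y in nhds x. f y < f x + e"
proof -
  have "Limsup (nhds x) (\<lambda>y. ereal (f y)) < ereal (f x + e)"
    using assms unfolding upper_semicontinuous_def upper_env_def
    by (metis less_add_same_cancel1 less_ereal.simps(1) order_le_less_trans)
  then have "\<forall>\<^sub>F y in nhds x. ereal (f y) < ereal (f x + e)" by (rule Limsup_lessD)
  then show ?thesis by simp
qed

lemma lower_semicontinuousD:
  assumes "lower_semicontinuous f" "e > 0"
  shows "\<forall>\<^sub>F y in nhds x. f x - e < f y"
proof -
  have "ereal (f x - e) < ereal (f x)" using assms by simp
  also have "\<dots> \<le> Liminf (nhds x) (\<lambda>y. ereal (f y))"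
    using assms unfolding lower_semicontinuous_def lower_env_def by blast
  finally have "\<forall>\<^sub>F y in nhds x. ereal (f x - e) < ereal (f y)" by (rule less_LiminfD)
  then show ?thesis by simp
qed

lemma viscosity_subsolutionD:
  assumes "viscosity_subsolution H \<alpha> h u" "(f0, Hf0) \<in> H"
    and "\<And>z. u z - f0 z \<le> u x - f0 x"
  shows "ereal (inverse \<alpha> * (u x - h x)) \<le> upper_env Hf0 x"
  using assms unfolding viscosity_subsolution_def by fast

lemma viscosity_supersolutionD:
  assumes "viscosity_supersolution H \<alpha> h v" "(f0, Hf0) \<in> H"
    and "\<And>z. f0 z - v z \<le> f0 x - v x"
  shows "lower_env Hf0 x \<le> ereal (inverse \<alpha> * (v x - h x))"
  using assms unfolding viscosity_supersolution_def by fast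

lemma grad_quadratic:
  fixes \<xi> :: "'e::real_inner"
  shows "grad (\<lambda>x. m / 2 * (norm (x - \<xi>))\<^sup>2) x = m *\<^sub>R (x - \<xi>)"
proof -
  let ?g = "\<lambda>x. m / 2 * (norm (x - \<xi>))\<^sup>2"
  have "((\<lambda>x. m / 2 * inner (x - \<xi>) (x - \<xi>)) has_derivative
      (\<lambda>v. m / 2 * (inner (x - \<xi>) v + inner v (x - \<xi>)))) (at x)"
    by (auto intro!: derivative_eq_intros)
  then have deriv: "GDERIV ?g x :> m *\<^sub>R (x - \<xi>)"
    unfolding gderiv_def power2_norm_eq_inner by (simp add: inner_commute)
  have "D = m *\<^sub>R (x - \<xi>)" if D: "GDERIV ?g x :> D" for D
  proof (rule vector_eq_inner)
    fix v
    have "(\<lambda>h. inner h D) = (\<lambda>h. inner h (m *\<^sub>R (x - \<xi>)))"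
      using has_derivative_unique[OF D[unfolded gderiv_def] deriv[unfolded gderiv_def]] .
    then show "inner v D = inner v (m *\<^sub>R (x - \<xi>))" by (rule fun_cong)
  qed
  with deriv show ?thesis unfolding grad_def by (rule the_equality)
qed

context
  fixes F :: "'e::{real_inner, complete_space} \<Rightarrow> 'e"
    and B :: "'e \<Rightarrow> 'u::{real_inner, complete_space} \<Rightarrow>\<^sub>L 'e"
begin

abbreviation adj :: "'e \<Rightarrow> 'e \<Rightarrow> 'u" where "adj x \<equiv> adjoint (blinfun_apply (B x))"

text \<open>A bound for the change of the Hamiltonian when the momentum \<open>p\<close> is perturbed by at most \<open>\<rho>\<close>,
  chosen to be continuous in the position; see \<open>hamiltonian_perturb\<close>.\<close>

definition momentum_modulus :: "real \<Rightarrow> 'e \<Rightarrow> 'e \<Rightarrow> real" where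
  "momentum_modulus \<rho> x p = \<rho> * (norm (F x) + (norm (B x))\<^sup>2 * (norm p + \<rho>))"

lemma hamiltonian_perturb:
  assumes q: "norm q \<le> \<rho>"
  shows "\<bar>hamiltonian F B x (p + q) - hamiltonian F B x p\<bar> \<le> momentum_modulus \<rho> x p"
proof -
  let ?P = "adj x p" and ?Q = "adj x q"
  let ?b = "norm (B x)"
  have "\<rho> \<ge> 0" using q norm_ge_zero order_trans by blast
  have P: "norm ?P \<le> ?b * norm p" by (rule norm_adjoint_le)
  have Q: "norm ?Q \<le> ?b * \<rho>"
    using norm_adjoint_le[of "B x" q] mult_left_mono[OF q, of ?b] by simp
  have "(norm (adj x (p + q)))\<^sup>2 = (norm ?P)\<^sup>2 + 2 * inner ?P ?Q + (norm ?Q)\<^sup>2"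
    by (simp add: adjoint_add power2_norm_eq_inner inner_add_left inner_add_right inner_commute)
  then have "hamiltonian F B x (p + q) - hamiltonian F B x p
      = inner (F x) q + inner ?P ?Q + 1/2 * (norm ?Q)\<^sup>2"
    unfolding hamiltonian_def inner_add_right by linarith
  then have "\<bar>hamiltonian F B x (p + q) - hamiltonian F B x p\<bar>
      \<le> \<bar>inner (F x) q\<bar> + \<bar>inner ?P ?Q\<bar> + \<bar>1/2 * (norm ?Q)\<^sup>2\<bar>"
    by linarith
  also have "\<bar>inner (F x) q\<bar> \<le> norm (F x) * \<rho>"
    using Cauchy_Schwarz_ineq2[of "F x" q] mult_left_mono[OF q, of "norm (F x)"] by simp
  also have "\<bar>inner ?P ?Q\<bar> \<le> (?b * norm p) * (?b * \<rho>)"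
    using Cauchy_Schwarz_ineq2[of ?P ?Q] mult_mono[OF P Q] \<open>\<rho> \<ge> 0\<close> by simp
  also have "\<bar>1/2 * (norm ?Q)\<^sup>2\<bar> \<le> (?b * \<rho>)\<^sup>2"
    using power_mono[OF Q norm_ge_zero, of 2] zero_le_power2[of "norm ?Q"] by linarith
  finally show ?thesis
    by (simp add: momentum_modulus_def algebra_simps power2_eq_square)
qed

lemma tendsto_adjoint:
  assumes "(f \<longlongrightarrow> p) (at x)" "isCont B x"
  shows "((\<lambda>y. adj y (f y)) \<longlongrightarrow> adj x p) (at x)"
proof (rule LIM_zero_cancel, rule Lim_null_comparison)
  have "((\<lambda>y. norm (B y) * norm (f y - p) + norm (B y - B x) * norm p)
      \<longlongrightarrow> norm (B x) * norm (p - p) + norm (B x - B x) * norm p) (at x)"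
    using assms(2) unfolding isCont_def by (intro tendsto_intros assms(1))
  then show "((\<lambda>y. norm (B y) * norm (f y - p) + norm (B y - B x) * norm p) \<longlongrightarrow> 0) (at x)"
    by simp
  show "\<forall>\<^sub>F y in at x. norm (adj y (f y) - adj x p)
      \<le> norm (B y) * norm (f y - p) + norm (B y - B x) * norm p"
    by (intro always_eventually allI norm_adjoint_diff_le)
qed

lemma isCont_hamiltonian:
  assumes "isCont F x" "isCont B x" "isCont f x"
  shows "isCont (\<lambda>y. hamiltonian F B y (f y)) x"
  using assms(1,3) tendsto_adjoint[OF _ assms(2)] unfolding isCont_def hamiltonian_def
  by (intro tendsto_intros) auto

lemma isCont_momentum_modulus:
  assumes "isCont F x" "isCont B x" "isCont f x"
  shows "isCont (\<lambda>y. momentum_modulus \<rho> y (f y)) x"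
  unfolding momentum_modulus_def by (intro continuous_intros assms)

text \<open>The supremum over the perturbations \<open>q\<close> is replaced by a majorant that is continuous in the
  position, so that the envelope can be evaluated.\<close>

lemma subsolution_test:
  assumes sub: "viscosity_subsolution (H0 C F B) \<alpha> h u"
    and cont: "isCont F x" "isCont B x"
    and pos: "\<mu> > 0" "\<rho> > 0" and \<xi>: "\<xi> \<in> Domain C"
    and max: "\<And>z. u z - (\<mu> / 2 * (norm (z - \<xi>))\<^sup>2 + \<rho> * tataru_dist C z y)
                 \<le> u x - (\<mu> / 2 * (norm (x - \<xi>))\<^sup>2 + \<rho> * tataru_dist C x y)"
  shows "inverse \<alpha> * (u x - h x) \<le> \<mu> * inner (x - \<xi>) (canonical_restriction C \<xi>) + \<rho>
    + hamiltonian F B x (\<mu> *\<^sub>R (x - \<xi>)) + momentum_modulus \<rho> x (\<mu> *\<^sub>R (x - \<xi>))"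
proof -
  let ?g = "\<lambda>x. \<mu> / 2 * (norm (x - \<xi>))\<^sup>2"
  let ?f0 = "\<lambda>x. ?g x + \<rho> * tataru_dist C x y"
  let ?Hf0 = "\<lambda>x. \<mu> * inner (x - \<xi>) (canonical_restriction C \<xi>) + \<rho>
             + (SUP q\<in>cball 0 \<rho>. hamiltonian F B x (grad ?g x + q))"
  let ?G = "\<lambda>x. \<mu> * inner (x - \<xi>) (canonical_restriction C \<xi>) + \<rho>
             + hamiltonian F B x (\<mu> *\<^sub>R (x - \<xi>)) + momentum_modulus \<rho> x (\<mu> *\<^sub>R (x - \<xi>))"
  have "(?f0, ?Hf0) \<in> H0 C F B"
    unfolding H0_def mem_Collect_eq
    by (intro exI[of _ ?g] exI[of _ \<mu>] exI[of _ \<rho>] exI[of _ \<xi>] exI[of _ y])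
       (simp add: pos \<xi>)
  then have "ereal (inverse \<alpha> * (u x - h x)) \<le> upper_env ?Hf0 x"
    by (rule viscosity_subsolutionD[OF sub]) (rule max)
  then show ?thesis
  proof (rule upper_env_bound)
    fix z
    have "(SUP q\<in>cball 0 \<rho>. hamiltonian F B z (grad ?g z + q))
        \<le> hamiltonian F B z (\<mu> *\<^sub>R (z - \<xi>)) + momentum_modulus \<rho> z (\<mu> *\<^sub>R (z - \<xi>))"
      unfolding grad_quadratic
    proof (rule cSUP_least)
      fix q :: 'e assume "q \<in> cball 0 \<rho>"
      then show "hamiltonian F B z (\<mu> *\<^sub>R (z - \<xi>) + q)
          \<le> hamiltonian F B z (\<mu> *\<^sub>R (z - \<xi>)) + momentum_modulus \<rho> z (\<mu> *\<^sub>R (z - \<xi>))"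
        using hamiltonian_perturb[of q \<rho> z "\<mu> *\<^sub>R (z - \<xi>)"] by (simp add: abs_le_iff)
    qed (use pos in simp)
    then show "?Hf0 z \<le> ?G z" by simp
  next
    show "isCont ?G x"
      by (intro continuous_intros isCont_hamiltonian isCont_momentum_modulus cont)
  qed
qed

lemma supersolution_test:
  assumes super: "viscosity_supersolution (H1 C F B) \<alpha> h v"
    and cont: "isCont F x" "isCont B x"
    and pos: "\<mu> > 0" "\<rho> > 0" and \<xi>: "\<xi> \<in> Domain C"
    and max: "\<And>z. - \<mu> / 2 * (norm (z - \<xi>))\<^sup>2 - \<rho> * tataru_dist C z y - v z
                 \<le> - \<mu> / 2 * (norm (x - \<xi>))\<^sup>2 - \<rho> * tataru_dist C x y - v x"
  shows "inverse \<alpha> * (v x - h x) \<ge> - \<mu> * inner (x - \<xi>) (canonical_restriction C \<xi>) - \<rho>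
    + hamiltonian F B x (\<mu> *\<^sub>R (\<xi> - x)) - momentum_modulus \<rho> x (\<mu> *\<^sub>R (\<xi> - x))"
proof -
  let ?g = "\<lambda>x. - \<mu> / 2 * (norm (x - \<xi>))\<^sup>2"
  let ?f0 = "\<lambda>x. ?g x - \<rho> * tataru_dist C x y"
  let ?Hf0 = "\<lambda>x. - \<mu> * inner (x - \<xi>) (canonical_restriction C \<xi>) - \<rho>
             + (INF q\<in>cball 0 \<rho>. hamiltonian F B x (grad ?g x + q))"
  let ?G = "\<lambda>x. - \<mu> * inner (x - \<xi>) (canonical_restriction C \<xi>) - \<rho>
             + hamiltonian F B x (\<mu> *\<^sub>R (\<xi> - x)) - momentum_modulus \<rho> x (\<mu> *\<^sub>R (\<xi> - x))"
  have "(?f0, ?Hf0) \<in> H1 C F B"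
    unfolding H1_def mem_Collect_eq
    by (intro exI[of _ ?g] exI[of _ \<mu>] exI[of _ \<rho>] exI[of _ \<xi>] exI[of _ y])
       (simp add: pos \<xi>)
  then have "lower_env ?Hf0 x \<le> ereal (inverse \<alpha> * (v x - h x))"
    by (rule viscosity_supersolutionD[OF super]) (rule max)
  then show ?thesis
  proof (rule lower_env_bound)
    fix z
    have grad: "grad ?g z = \<mu> *\<^sub>R (\<xi> - z)"
      using grad_quadratic[of "- \<mu>" \<xi> z] by (simp add: algebra_simps)
    have "hamiltonian F B z (\<mu> *\<^sub>R (\<xi> - z)) - momentum_modulus \<rho> z (\<mu> *\<^sub>R (\<xi> - z))
        \<le> (INF q\<in>cball 0 \<rho>. hamiltonian F B z (grad ?g z + q))"
      unfolding grad
    proof (rule cINF_greatest)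
      fix q :: 'e assume "q \<in> cball 0 \<rho>"
      then show "hamiltonian F B z (\<mu> *\<^sub>R (\<xi> - z)) - momentum_modulus \<rho> z (\<mu> *\<^sub>R (\<xi> - z))
          \<le> hamiltonian F B z (\<mu> *\<^sub>R (\<xi> - z) + q)"
        using hamiltonian_perturb[of q \<rho> z "\<mu> *\<^sub>R (\<xi> - z)"] by (simp add: abs_le_iff)
    qed (use pos in simp)
    then show "?G z \<le> ?Hf0 z" by simp
  next
    show "isCont ?G x"
      by (intro continuous_intros isCont_hamiltonian isCont_momentum_modulus cont)
  qed
qed

context
  fixes C :: "'e graph"
  assumes C: "m_dissipative C" and dense: "closure (Domain C) = UNIV"
    and cont: "\<And>x. isCont F x" "\<And>x. isCont B x"
begin

lemma ekeland_quadratic: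
  fixes f :: "'e \<Rightarrow> real"
  assumes usc: "\<And>x e. e > 0 \<Longrightarrow> \<forall>\<^sub>F y in nhds x. f y < f x + e"
    and bdd: "\<And>x. f x \<le> K" and pos: "b > 0" "\<rho> > 0"
  obtains x1 where "f x0 - b / 2 * (norm (x0 - \<xi>))\<^sup>2 \<le> f x1 - b / 2 * (norm (x1 - \<xi>))\<^sup>2"
    "\<And>x. f x - b / 2 * (norm (x - \<xi>))\<^sup>2 - \<rho> * tataru_dist C x x1 \<le> f x1 - b / 2 * (norm (x1 - \<xi>))\<^sup>2"
proof -
  let ?\<psi> = "\<lambda>x. f x - b / 2 * (norm (x - \<xi>))\<^sup>2"
  have "\<forall>\<^sub>F y in nhds x. ?\<psi> y < ?\<psi> x + e" if "e > 0" for x e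
  proof -
    have "((\<lambda>y. b / 2 * (norm (y - \<xi>))\<^sup>2) \<longlongrightarrow> b / 2 * (norm (x - \<xi>))\<^sup>2) (nhds x)"
      by (intro isCont_nhds continuous_intros)
    then have "\<forall>\<^sub>F y in nhds x. b / 2 * (norm (x - \<xi>))\<^sup>2 - e / 2 < b / 2 * (norm (y - \<xi>))\<^sup>2"
      by (rule order_tendstoD) (use that in simp)
    moreover have "\<forall>\<^sub>F y in nhds x. f y < f x + e / 2" using usc[of "e / 2" x] that by simp
    ultimately show ?thesis by eventually_elim linarith
  qed
  moreover have "?\<psi> x \<le> K" for x
  proof -
    have "0 \<le> b / 2 * (norm (x - \<xi>))\<^sup>2" using pos(1) by simp
    then show ?thesis using bdd[of x] by linarith
  qed
  moreover have "tataru_dist C x z \<le> tataru_dist C y z + dist x y" for x y z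
    unfolding dist_norm by (rule tataru_dist_lipschitz)
  ultimately show thesis
    by (rule ekeland[where ?x0.0 = x0, OF _ _ tataru_dist_nonneg tataru_dist_refl
          tataru_dist_triangle[OF C dense] _ tataru_dist_forward_Cauchy[OF C dense] pos(2)])
       (blast intro: that)+
qed

text \<open>For the multiple \<open>\<theta> u\<close> of a subsolution, maximised with the penalty \<open>b/2 \<parallel>x - \<xi>\<parallel>\<^sup>2\<close>: Ekeland's
  principle turns the arbitrary starting point \<open>x0\<close> into a genuine maximum of \<open>\<theta> u\<close> minus the
  penalty and \<open>\<rho>\<close> times a Tataru distance; division by \<open>\<theta>\<close> makes this an admissible test function.
  Multiplying the resulting inequality by \<open>\<theta>\<close> again leaves the factor \<open>1/\<theta>\<close> on the quadratic part
  of the Hamiltonian, which is where strict convexity enters the comparison.  The parameter \<open>\<rho>\<close> is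
  independent of \<open>x0\<close>.\<close>

lemma subsolution_near:
  assumes sub: "viscosity_subsolution (H0 C F B) \<alpha> h u"
    and pos: "b > 0" "\<rho> > 0" and \<theta>: "\<theta> \<ge> 1" and \<xi>: "\<xi> \<in> Domain C"
  obtains x where "\<theta> * u x0 - b / 2 * (norm (x0 - \<xi>))\<^sup>2 \<le> \<theta> * u x - b / 2 * (norm (x - \<xi>))\<^sup>2"
    "inverse \<alpha> * (\<theta> * (u x - h x)) \<le> b * inner (x - \<xi>) (canonical_restriction C \<xi>)
      + inner (F x) (b *\<^sub>R (x - \<xi>)) + 1 / (2 * \<theta>) * (norm (adj x (b *\<^sub>R (x - \<xi>))))\<^sup>2
      + (\<rho> + momentum_modulus \<rho> x (b *\<^sub>R (x - \<xi>)))"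
proof -
  have usc: "upper_semicontinuous u" and "bounded (range u)"
    using sub by (auto simp: viscosity_subsolution_def)
  then obtain K where K: "\<And>x. u x \<le> K"
    using bounded_imp_bdd_above[of "range u"] by (auto simp: bdd_above_def)
  have "\<forall>\<^sub>F y in nhds x. \<theta> * u y < \<theta> * u x + e" if "e > 0" for x e
  proof -
    have "\<forall>\<^sub>F y in nhds x. u y < u x + e / \<theta>"
      using upper_semicontinuousD[OF usc] that \<theta> by simp
    then show ?thesis by eventually_elim (use \<theta> in \<open>simp add: field_simps\<close>)
  qed
  then obtain x where x: "\<theta> * u x0 - b / 2 * (norm (x0 - \<xi>))\<^sup>2 \<le> \<theta> * u x - b / 2 * (norm (x - \<xi>))\<^sup>2"
    and max: "\<And>z. \<theta> * u z - b / 2 * (norm (z - \<xi>))\<^sup>2 - \<rho> * tataru_dist C z x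
      \<le> \<theta> * u x - b / 2 * (norm (x - \<xi>))\<^sup>2"
    using ekeland_quadratic[of "\<lambda>x. \<theta> * u x" "\<theta> * K" b \<rho> x0 \<xi>] K pos \<theta> by auto
  define p where "p = b *\<^sub>R (x - \<xi>)"
  have "u z - (b / \<theta> / 2 * (norm (z - \<xi>))\<^sup>2 + \<rho> / \<theta> * tataru_dist C z x)
      \<le> u x - (b / \<theta> / 2 * (norm (x - \<xi>))\<^sup>2 + \<rho> / \<theta> * tataru_dist C x x)" for z
    using divide_right_mono[OF max[of z], of \<theta>] \<theta>
    by (simp add: tataru_dist_refl diff_divide_distrib)
  then have "inverse \<alpha> * (u x - h x) \<le> b / \<theta> * inner (x - \<xi>) (canonical_restriction C \<xi>) + \<rho> / \<theta>
    + hamiltonian F B x ((b / \<theta>) *\<^sub>R (x - \<xi>)) + momentum_modulus (\<rho> / \<theta>) x ((b / \<theta>) *\<^sub>R (x - \<xi>))"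
    by (intro subsolution_test[OF sub cont _ _ \<xi>]) (use pos \<theta> in auto)
  also have "(b / \<theta>) *\<^sub>R (x - \<xi>) = (1 / \<theta>) *\<^sub>R p" by (simp add: p_def)
  finally have "\<theta> * (inverse \<alpha> * (u x - h x)) \<le> \<theta> * (b / \<theta> * inner (x - \<xi>) (canonical_restriction C \<xi>)
     + \<rho> / \<theta> + hamiltonian F B x ((1 / \<theta>) *\<^sub>R p) + momentum_modulus (\<rho> / \<theta>) x ((1 / \<theta>) *\<^sub>R p))"
    using \<theta> by (intro mult_left_mono) auto
  also have "\<dots> = b * inner (x - \<xi>) (canonical_restriction C \<xi>) + \<rho>
      + \<theta> * hamiltonian F B x ((1 / \<theta>) *\<^sub>R p) + \<theta> * momentum_modulus (\<rho> / \<theta>) x ((1 / \<theta>) *\<^sub>R p)"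
    using \<theta> by (simp add: distrib_left)
  also have "\<theta> * hamiltonian F B x ((1 / \<theta>) *\<^sub>R p) = inner (F x) p + 1 / (2 * \<theta>) * (norm (adj x p))\<^sup>2"
    using \<theta> by (simp add: hamiltonian_def adjoint_scale power_mult_distrib field_simps power2_eq_square)
  also have "\<theta> * momentum_modulus (\<rho> / \<theta>) x ((1 / \<theta>) *\<^sub>R p) \<le> momentum_modulus \<rho> x p"
  proof -
    have "norm p / \<theta> + \<rho> / \<theta> \<le> norm p + \<rho>"
      using \<theta> pos by (intro add_mono) (auto simp: field_simps mult_le_cancel_left1 mult_le_cancel_right1)
    then have "\<rho> * (norm (F x) + (norm (B x))\<^sup>2 * (norm p / \<theta> + \<rho> / \<theta>)) \<le> momentum_modulus \<rho> x p"
      unfolding momentum_modulus_def using pos by (intro mult_left_mono add_left_mono) auto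
    then show ?thesis using \<theta> by (simp add: momentum_modulus_def)
  qed
  finally have "inverse \<alpha> * (\<theta> * (u x - h x)) \<le> b * inner (x - \<xi>) (canonical_restriction C \<xi>)
      + inner (F x) p + 1 / (2 * \<theta>) * (norm (adj x p))\<^sup>2 + (\<rho> + momentum_modulus \<rho> x p)"
    by (simp add: algebra_simps)
  then show thesis using x that by (simp add: p_def)
qed

lemma supersolution_near:
  assumes super: "viscosity_supersolution (H1 C F B) \<alpha> h v"
    and pos: "b > 0" "\<rho> > 0" and \<eta>: "\<eta> \<in> Domain C"
  obtains y where "- v y0 - b / 2 * (norm (y0 - \<eta>))\<^sup>2 \<le> - v y - b / 2 * (norm (y - \<eta>))\<^sup>2"
    "inverse \<alpha> * (v y - h y) \<ge> - b * inner (y - \<eta>) (canonical_restriction C \<eta>)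
      + hamiltonian F B y (b *\<^sub>R (\<eta> - y)) - (\<rho> + momentum_modulus \<rho> y (b *\<^sub>R (\<eta> - y)))"
proof -
  have lsc: "lower_semicontinuous v" and "bounded (range v)"
    using super by (auto simp: viscosity_supersolution_def)
  then obtain K where K: "\<And>x. K \<le> v x"
    using bounded_imp_bdd_below[of "range v"] by (auto simp: bdd_below_def)
  have "\<forall>\<^sub>F z in nhds y. - v z < - v y + e" if "e > 0" for y e
    using lower_semicontinuousD[OF lsc that, of y] by eventually_elim simp
  then obtain y where y: "- v y0 - b / 2 * (norm (y0 - \<eta>))\<^sup>2 \<le> - v y - b / 2 * (norm (y - \<eta>))\<^sup>2"
    and max: "\<And>z. - v z - b / 2 * (norm (z - \<eta>))\<^sup>2 - \<rho> * tataru_dist C z y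
      \<le> - v y - b / 2 * (norm (y - \<eta>))\<^sup>2"
    using ekeland_quadratic[of "\<lambda>y. - v y" "- K" b \<rho> y0 \<eta>] K pos by auto
  have "- b / 2 * (norm (z - \<eta>))\<^sup>2 - \<rho> * tataru_dist C z y - v z
      \<le> - b / 2 * (norm (y - \<eta>))\<^sup>2 - \<rho> * tataru_dist C y y - v y" for z
    using max[of z] by (simp add: tataru_dist_refl)
  from supersolution_test[OF super cont pos \<eta> this] show thesis
    using y that by (simp add: algebra_simps)
qed

end

end

section \<open>Penalised near-maximisers with base points in the domain\<close>

definition chain_sq :: "'e::real_inner \<Rightarrow> 'e \<Rightarrow> 'e \<Rightarrow> 'e \<Rightarrow> real" where
  "chain_sq x \<xi> \<eta> y = (norm (x - \<xi>))\<^sup>2 + (norm (\<xi> - \<eta>))\<^sup>2 + (norm (\<eta> - y))\<^sup>2"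

text \<open>The variables are doubled twice: \<open>x\<close> and \<open>y\<close> carry the solutions, \<open>\<xi>\<close> and \<open>\<eta>\<close> will be the base
  points of the test functions.  The chain couples \<open>x\<close> to \<open>\<xi>\<close>, \<open>\<xi>\<close> to \<open>\<eta>\<close> and \<open>\<eta>\<close> to \<open>y\<close>.
  Localisation acts on \<open>\<xi>\<close> and \<open>\<eta>\<close> only, as the penalties in \<open>x\<close> and \<open>y\<close> have to be
  quadratics centred at points of the domain of \<open>C\<close>.\<close>

definition quadrupled ::
    "('e::real_inner \<Rightarrow> real) \<Rightarrow> ('e \<Rightarrow> real) \<Rightarrow> real \<Rightarrow> real \<Rightarrow> 'e \<Rightarrow> 'e \<Rightarrow> 'e \<Rightarrow> 'e \<Rightarrow> real" where
  "quadrupled U V b \<epsilon> x \<xi> \<eta> y =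
     U x - V y - b / 2 * chain_sq x \<xi> \<eta> y - \<epsilon> / 2 * ((norm \<xi>)\<^sup>2 + (norm \<eta>)\<^sup>2)"

text \<open>The gradient of \<open>quadrupled\<close> with respect to \<open>\<xi>\<close>; with \<open>x\<close>, \<open>\<xi>\<close>, \<open>\<eta>\<close> replaced by \<open>y\<close>, \<open>\<eta>\<close>,
  \<open>\<xi>\<close> it is the gradient with respect to \<open>\<eta>\<close>.\<close>

definition residual :: "real \<Rightarrow> real \<Rightarrow> 'e::real_inner \<Rightarrow> 'e \<Rightarrow> 'e \<Rightarrow> 'e" where
  "residual b \<epsilon> x \<xi> \<eta> = b *\<^sub>R (x - \<xi>) - b *\<^sub>R (\<xi> - \<eta>) - \<epsilon> *\<^sub>R \<xi>"

text \<open>Exchanging the roles of \<open>(x, \<xi>)\<close> and \<open>(y, \<eta>)\<close>, which reduces statements about \<open>\<eta>\<close> to statements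
  about \<open>\<xi>\<close>.\<close>

lemma quadrupled_swap:
  "quadrupled (\<lambda>z. - V z) (\<lambda>z. - U z) b \<epsilon> y \<eta> \<xi> x = quadrupled U V b \<epsilon> x \<xi> \<eta> y"
  by (simp add: quadrupled_def chain_sq_def norm_minus_commute algebra_simps)

lemma norm_sq_add: "(norm (a + h))\<^sup>2 = (norm a)\<^sup>2 + 2 * inner a h + (norm h)\<^sup>2"
  for a h :: "'e::real_inner"
  by (simp add: power2_norm_eq_inner inner_add_left inner_add_right inner_commute)

lemma norm_sq_diff: "(norm (a - h))\<^sup>2 = (norm a)\<^sup>2 - 2 * inner a h + (norm h)\<^sup>2"
  for a h :: "'e::real_inner"
  by (simp add: power2_norm_eq_inner inner_diff_left inner_diff_right inner_commute)

lemma quadrupled_expansion: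
  "quadrupled U V b \<epsilon> x (\<xi> + h) \<eta> y = quadrupled U V b \<epsilon> x \<xi> \<eta> y
     + inner (residual b \<epsilon> x \<xi> \<eta>) h - (2 * b + \<epsilon>) / 2 * (norm h)\<^sup>2"
proof -
  have x: "(norm (x - (\<xi> + h)))\<^sup>2 = (norm (x - \<xi>))\<^sup>2 - 2 * inner (x - \<xi>) h + (norm h)\<^sup>2"
    using norm_sq_diff[of "x - \<xi>" h] by (simp add: algebra_simps)
  have \<eta>: "(norm (\<xi> + h - \<eta>))\<^sup>2 = (norm (\<xi> - \<eta>))\<^sup>2 + 2 * inner (\<xi> - \<eta>) h + (norm h)\<^sup>2"
    using norm_sq_add[of "\<xi> - \<eta>" h] by (simp add: algebra_simps)
  show ?thesis
    unfolding quadrupled_def chain_sq_def residual_def norm_sq_add[of \<xi> h] x \<eta>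
    by (simp add: inner_diff_left algebra_simps add_divide_distrib diff_divide_distrib)
qed

lemma approx_sup:
  fixes f :: "'a \<Rightarrow> real"
  assumes "\<And>p. p \<in> S \<Longrightarrow> f p \<le> K" "S \<noteq> {}"
  obtains m where "\<And>p. p \<in> S \<Longrightarrow> f p \<le> m" "\<And>e. e > 0 \<Longrightarrow> \<exists>p\<in>S. m - e < f p"
proof
  have bdd: "bdd_above (f ` S)" using assms(1) by (rule bdd_aboveI2)
  show "f p \<le> (SUP p\<in>S. f p)" if "p \<in> S" for p using that bdd by (rule cSUP_upper)
  show "\<exists>p\<in>S. (SUP p\<in>S. f p) - e < f p" if "e > 0" for e
    using less_cSUP_iff[OF assms(2) bdd, of "(SUP p\<in>S. f p) - e"] that by simp
qed

lemma dense_meets_open: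
  assumes "closure D = UNIV" "open A" "x \<in> A"
  obtains x' where "x' \<in> D" "x' \<in> A"
  using assms open_Int_closure_eq_empty[of A D] by blast

text \<open>The optimality of \<open>\<xi>\<close> is tested along the flow of \<open>C\<close>.  Suppose that the pair \<open>(\<xi>, w)\<close> in \<open>C\<close>
  maximises \<open>G - \<kappa>/2 \<parallel>w\<parallel>\<^sup>2\<close> over \<open>C\<close> up to \<open>r\<^sup>2\<close>, and compare it with the resolvent of step \<open>r\<close> and
  the Yosida value \<open>A\<close>.  Since \<open>\<parallel>A\<parallel> \<le> \<parallel>C\<^sup>0 \<xi>\<parallel> \<le> \<parallel>w\<parallel>\<close>, the penalty does not
  increase, so moving in the direction \<open>A\<close> cannot raise \<open>G\<close> much: \<open>\<langle>g, A\<rangle>\<close> is at most of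
  order \<open>r\<close>.  Conversely the penalty cannot decrease much either, so \<open>\<parallel>C\<^sup>0 \<xi>\<parallel>\<^sup>2 - \<parallel>A\<parallel>\<^sup>2\<close>
  is small, and this difference bounds \<open>\<parallel>A - C\<^sup>0 \<xi>\<parallel>\<^sup>2\<close>.  The bound depends on \<open>\<xi>\<close>
  only through \<open>W\<close> and \<open>s\<close>, hence the accuracy \<open>r\<close> can be fixed before \<open>\<xi>\<close> is chosen.\<close>

lemma near_optimal_canonical:
  fixes C :: "'e::{real_inner, complete_space} graph"
  assumes C: "m_dissipative C" and \<xi>: "(\<xi>, w) \<in> C"
    and pos: "c > 0" "\<kappa> > 0" "r > 0"
    and quad: "\<And>h. G (\<xi> + h) = G \<xi> + inner g h - c / 2 * (norm h)\<^sup>2"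
    and opt: "\<And>\<zeta> \<nu>. (\<zeta>, \<nu>) \<in> C \<Longrightarrow> G \<zeta> - \<kappa> / 2 * (norm \<nu>)\<^sup>2 \<le> G \<xi> - \<kappa> / 2 * (norm w)\<^sup>2 + r\<^sup>2"
    and W: "norm w \<le> W" and s: "norm g \<le> s"
  shows "inner g (canonical_restriction C \<xi>)
    \<le> c * r * W\<^sup>2 / 2 + r + s * sqrt (2 / \<kappa> * (r * (s * W) + c * r\<^sup>2 * W\<^sup>2 / 2 + r\<^sup>2))"
proof -
  define A where "A = yosida C r \<xi>"
  define w0 where "w0 = canonical_restriction C \<xi>"
  have dom: "\<xi> \<in> Domain C" using \<xi> by blast
  have w0: "(\<xi>, w0) \<in> C" "norm w0 \<le> norm w"
    unfolding w0_def using canonical_restriction_in[OF C dom] canonical_restriction_min[OF C dom \<xi>] by auto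
  have A_le: "norm A \<le> W"
    using norm_yosida_le[OF C pos(3) \<xi>] W by (simp add: A_def)
  have "W \<ge> 0" "s \<ge> 0" using W s norm_ge_zero order_trans by blast+
  have "(\<xi> + r *\<^sub>R A, A) \<in> C"
    using yosida_in[OF C pos(3), of \<xi>] resolvent_eq[OF C pos(3), of \<xi>] by (simp add: A_def)
  from opt[OF this] have *: "r * inner g A + \<kappa> / 2 * ((norm w)\<^sup>2 - (norm A)\<^sup>2) \<le> c / 2 * (r\<^sup>2 * (norm A)\<^sup>2) + r\<^sup>2"
    unfolding quad by (simp add: power_mult_distrib right_diff_distrib)
  have AW: "c / 2 * (r\<^sup>2 * (norm A)\<^sup>2) \<le> c / 2 * (r\<^sup>2 * W\<^sup>2)"
    using pos A_le by (intro mult_left_mono power_mono) auto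
  have "norm A \<le> norm w" using norm_yosida_le[OF C pos(3) \<xi>] by (simp add: A_def)
  then have "0 \<le> \<kappa> / 2 * ((norm w)\<^sup>2 - (norm A)\<^sup>2)" using pos by (simp add: power_mono)
  with * AW have "r * inner g A \<le> r * (c * r * W\<^sup>2 / 2 + r)"
    by (simp add: algebra_simps power2_eq_square)
  then have gA: "inner g A \<le> c * r * W\<^sup>2 / 2 + r" using pos by simp
  have "- inner g A \<le> norm g * norm A"
    using norm_cauchy_schwarz[of "- g" A] by simp
  also have "\<dots> \<le> s * W" using s A_le \<open>s \<ge> 0\<close> by (intro mult_mono) auto
  finally have "- (r * inner g A) \<le> r * (s * W)"
    using pos mult_left_mono[of "- inner g A" "s * W" r] by simp
  with * AW have "\<kappa> / 2 * ((norm w)\<^sup>2 - (norm A)\<^sup>2) \<le> r * (s * W) + c * r\<^sup>2 * W\<^sup>2 / 2 + r\<^sup>2"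
    by (simp add: algebra_simps)
  then have "(norm w)\<^sup>2 - (norm A)\<^sup>2 \<le> 2 / \<kappa> * (r * (s * W) + c * r\<^sup>2 * W\<^sup>2 / 2 + r\<^sup>2)"
    using pos by (simp add: field_simps)
  moreover have "(norm (A - w0))\<^sup>2 \<le> (norm w0)\<^sup>2 - (norm A)\<^sup>2"
    unfolding A_def by (rule norm_yosida_diff[OF C pos(3) w0(1)])
  moreover have "(norm w0)\<^sup>2 \<le> (norm w)\<^sup>2" using w0(2) by (simp add: power_mono)
  ultimately have "(norm (A - w0))\<^sup>2 \<le> 2 / \<kappa> * (r * (s * W) + c * r\<^sup>2 * W\<^sup>2 / 2 + r\<^sup>2)" by linarith
  then have dist: "norm (A - w0) \<le> sqrt (2 / \<kappa> * (r * (s * W) + c * r\<^sup>2 * W\<^sup>2 / 2 + r\<^sup>2))"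
    by (rule real_le_rsqrt)
  have "inner g (w0 - A) \<le> norm g * norm (A - w0)"
    using norm_cauchy_schwarz[of g "w0 - A"] by (simp add: norm_minus_commute)
  also have "\<dots> \<le> s * sqrt (2 / \<kappa> * (r * (s * W) + c * r\<^sup>2 * W\<^sup>2 / 2 + r\<^sup>2))"
    using s dist \<open>s \<ge> 0\<close> by (intro mult_mono) auto
  finally show ?thesis using gA by (simp add: w0_def inner_diff_right)
qed

lemma small_step:
  fixes c W s \<kappa> :: real
  assumes "\<theta> > 0" "\<delta> > 0"
  obtains r where "r > 0" "r\<^sup>2 \<le> \<theta>"
    "c * r * W\<^sup>2 / 2 + r + s * sqrt (2 / \<kappa> * (r * (s * W) + c * r\<^sup>2 * W\<^sup>2 / 2 + r\<^sup>2)) \<le> \<delta>"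
proof -
  let ?f = "\<lambda>r. c * r * W\<^sup>2 / 2 + r + s * sqrt (2 / \<kappa> * (r * (s * W) + c * r\<^sup>2 * W\<^sup>2 / 2 + r\<^sup>2))"
  have "(?f \<longlongrightarrow> c * 0 * W\<^sup>2 / 2 + 0 + s * sqrt (2 / \<kappa> * (0 * (s * W) + c * 0\<^sup>2 * W\<^sup>2 / 2 + 0\<^sup>2))) (at_right 0)"
    by (intro tendsto_intros) simp_all
  then have "(?f \<longlongrightarrow> 0) (at_right 0)" by simp
  then have "\<forall>\<^sub>F r in at_right 0. ?f r < \<delta>" using assms(2) by (rule order_tendstoD)
  moreover have "((\<lambda>r. r\<^sup>2) \<longlongrightarrow> 0\<^sup>2) (at_right (0::real))" by (intro tendsto_intros)
  then have "\<forall>\<^sub>F r in at_right 0. r\<^sup>2 < \<theta>"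
    by (rule order_tendstoD) (use assms(1) in simp)
  moreover have "\<forall>\<^sub>F r in at_right 0. 0 < (r::real)" by (simp add: eventually_at_right_less)
  ultimately have "\<forall>\<^sub>F r in at_right 0. 0 < r \<and> r\<^sup>2 < \<theta> \<and> ?f r < \<delta>"
    by eventually_elim simp
  then obtain r where "0 < r \<and> r\<^sup>2 < \<theta> \<and> ?f r < \<delta>"
    using eventually_happens'[OF trivial_limit_at_right_real] by blast
  then show thesis by (intro that[of r]) auto
qed

lemma quadrupled_le:
  assumes "\<And>x. U x \<le> K" "\<And>y. - V y \<le> K" "b \<ge> 0" "\<epsilon> \<ge> 0"
  shows "quadrupled U V b \<epsilon> x \<xi> \<eta> y \<le> 2 * K"
proof -
  have "0 \<le> b / 2 * chain_sq x \<xi> \<eta> y" "0 \<le> \<epsilon> / 2 * ((norm \<xi>)\<^sup>2 + (norm \<eta>)\<^sup>2)"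
    using assms(3,4) by (simp_all add: chain_sq_def)
  then show ?thesis using assms(1)[of x] assms(2)[of y] unfolding quadrupled_def by linarith
qed

text \<open>The supremum decreases when \<open>b\<close> is doubled and stays above the diagonal values, so some doubling
  lowers it by at most \<open>\<delta>\<close>.  At near-maximisers for such a \<open>b\<close> the penalty itself is of order
  \<open>\<delta>\<close>.\<close>

lemma penalty_level:
  fixes U V :: "'e::real_inner \<Rightarrow> real"
  assumes bdd: "\<And>x. U x \<le> K" "\<And>y. - V y \<le> K" and "b0 > 0" "\<delta> > 0"
  obtains b m where "b \<ge> b0" "\<And>x \<xi> \<eta> y. quadrupled U V b 0 x \<xi> \<eta> y \<le> m"
    "\<And>x \<xi> \<eta> y. quadrupled U V (b / 2) 0 x \<xi> \<eta> y \<le> m + \<delta>"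
    "\<exists>x \<xi> \<eta> y. m - \<delta> < quadrupled U V b 0 x \<xi> \<eta> y"
proof -
  let ?Q = "\<lambda>b (x, \<xi>, \<eta>, y). quadrupled U V b 0 x \<xi> \<eta> y"
  define M where "M b = (SUP p. ?Q b p)" for b
  have bddQ: "bdd_above (range (?Q b))" if "b \<ge> 0" for b
    by (rule bdd_aboveI2[of _ _ "2 * K"]) (use quadrupled_le[of U K V b 0, OF bdd that] in auto)
  have le_M: "quadrupled U V b 0 x \<xi> \<eta> y \<le> M b" if "b \<ge> 0" for b x \<xi> \<eta> y
    using cSUP_upper[OF UNIV_I bddQ[OF that], of "(x, \<xi>, \<eta>, y)"] by (simp add: M_def)
  define B where "B n = b0 * 2 ^ n" for n :: nat
  have B: "B n \<ge> b0" "B n \<ge> 0" "B (Suc n) / 2 = B n" for n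
    using \<open>b0 > 0\<close> by (simp_all add: B_def mult_le_cancel_left1)
  have "\<exists>n. M (B n) \<le> M (B (Suc n)) + \<delta>"
  proof (rule ccontr)
    assume "\<not> ?thesis"
    then have drop: "M (B (Suc n)) < M (B n) - \<delta>" for n by (simp add: not_le algebra_simps)
    have "M (B n) \<le> M (B 0) - real n * \<delta>" for n
    proof (induction n)
      case (Suc n)
      then show ?case using drop[of n] by (simp add: algebra_simps)
    qed simp
    moreover obtain n where "M (B 0) - (U 0 - V 0) < real n * \<delta>"
      using reals_Archimedean3[OF \<open>\<delta> > 0\<close>] by blast
    moreover have "U 0 - V 0 \<le> M (B n)"
      using le_M[OF B(2)[of n], of 0 0 0 0] by (simp add: quadrupled_def chain_sq_def)
    ultimately show False by (smt (verit))
  qed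
  then obtain n where n: "M (B n) \<le> M (B (Suc n)) + \<delta>" by blast
  have "quadrupled U V (B (Suc n) / 2) 0 x \<xi> \<eta> y \<le> M (B (Suc n)) + \<delta>" for x \<xi> \<eta> y
    unfolding B(3) using le_M[OF B(2)[of n]] n by (rule order_trans)
  moreover have "\<exists>p. M (B (Suc n)) - \<delta> < ?Q (B (Suc n)) p"
    using less_cSUP_iff[OF _ bddQ[OF B(2)[of "Suc n"]], of "M (B (Suc n)) - \<delta>"] \<open>\<delta> > 0\<close>
    by (simp add: M_def)
  then have "\<exists>x \<xi> \<eta> y. M (B (Suc n)) - \<delta> < quadrupled U V (B (Suc n)) 0 x \<xi> \<eta> y" by auto
  ultimately show thesis using that B(1)[of "Suc n"] le_M[OF B(2)[of "Suc n"]] by blast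
qed

text \<open>Moving \<open>\<xi>\<close> by \<open>g / (2 b + \<epsilon>)\<close>, where \<open>g\<close> is the residual, raises \<open>quadrupled\<close> by
  \<open>\<parallel>g\<parallel>\<^sup>2 / (2 (2 b + \<epsilon>))\<close>; this cannot exceed the distance \<open>3 \<theta>\<close> from its upper bound.\<close>

lemma near_maximal_residual:
  fixes C :: "'e::{real_inner, complete_space} graph"
  assumes C: "m_dissipative C" and \<xi>: "(\<xi>, w) \<in> C"
    and pos: "b > 0" "\<epsilon> > 0" "\<kappa> > 0" "r > 0"
    and le: "\<And>\<zeta>. quadrupled U V b \<epsilon> x \<zeta> \<eta> y \<le> M"
    and near: "M - 3 * \<theta> \<le> quadrupled U V b \<epsilon> x \<xi> \<eta> y" "6 * (2 * b + \<epsilon>) * \<theta> \<le> \<epsilon>\<^sup>2"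
    and opt: "\<And>\<zeta> \<nu>. (\<zeta>, \<nu>) \<in> C \<Longrightarrow> quadrupled U V b \<epsilon> x \<zeta> \<eta> y - \<kappa> / 2 * (norm \<nu>)\<^sup>2
                \<le> quadrupled U V b \<epsilon> x \<xi> \<eta> y - \<kappa> / 2 * (norm w)\<^sup>2 + r\<^sup>2"
    and W: "norm w \<le> W"
    and step: "(2 * b + \<epsilon>) * r * W\<^sup>2 / 2 + r
      + \<epsilon> * sqrt (2 / \<kappa> * (r * (\<epsilon> * W) + (2 * b + \<epsilon>) * r\<^sup>2 * W\<^sup>2 / 2 + r\<^sup>2)) \<le> \<delta>"
  shows "norm (residual b \<epsilon> x \<xi> \<eta>) \<le> \<epsilon>"
    and "inner (residual b \<epsilon> x \<xi> \<eta>) (canonical_restriction C \<xi>) \<le> \<delta>"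
proof -
  let ?g = "residual b \<epsilon> x \<xi> \<eta>" and ?c = "2 * b + \<epsilon>"
  have c: "?c > 0" using pos by simp
  define d where "d = (norm ?g)\<^sup>2 / ?c"
  have "quadrupled U V b \<epsilon> x \<xi> \<eta> y + inner ?g ((1 / ?c) *\<^sub>R ?g) - ?c / 2 * (norm ((1 / ?c) *\<^sub>R ?g))\<^sup>2 \<le> M"
    using le[of "\<xi> + (1 / ?c) *\<^sub>R ?g"] unfolding quadrupled_expansion .
  also have "inner ?g ((1 / ?c) *\<^sub>R ?g) = (norm ?g)\<^sup>2 / ?c"
    by (simp add: power2_norm_eq_inner)
  also have "?c / 2 * (norm ((1 / ?c) *\<^sub>R ?g))\<^sup>2 = (norm ?g)\<^sup>2 / ?c / 2"
    using c by (simp add: power_divide power2_eq_square)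
  finally have "quadrupled U V b \<epsilon> x \<xi> \<eta> y + d - d / 2 \<le> M" unfolding d_def .
  then have "d \<le> 6 * \<theta>" using near(1) by linarith
  then have "(norm ?g)\<^sup>2 \<le> 6 * ?c * \<theta>" using c by (simp add: d_def pos_divide_le_eq algebra_simps)
  then have "(norm ?g)\<^sup>2 \<le> \<epsilon>\<^sup>2" using near(2) by linarith
  then show g: "norm ?g \<le> \<epsilon>" using pos(2) by (meson less_imp_le power2_le_imp_le)
  from near_optimal_canonical[OF C \<xi> c pos(3,4), of "\<lambda>\<zeta>. quadrupled U V b \<epsilon> x \<zeta> \<eta> y", OF quadrupled_expansion opt W g]
  show "inner ?g (canonical_restriction C \<xi>) \<le> \<delta>" using step by linarith
qed

text \<open>The parameters are chosen in the order \<open>b\<close> (the penalty on the chain), \<open>\<epsilon>\<close> (localisation),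
  \<open>\<theta>\<close> (how nearly the supremum is attained), \<open>\<kappa>\<close> (penalty on the values of \<open>C\<close>, which also
  confines \<open>\<xi>\<close> and \<open>\<eta>\<close> to the domain) and \<open>r\<close> (accuracy of near-maximality given \<open>\<kappa>\<close>).

  The conclusions are claimed for every \<open>(x, y)\<close> that does at least as well as \<open>(x0, y0)\<close> with
  \<open>\<xi>\<close> and \<open>\<eta>\<close> kept fixed: near-maximality survives such a replacement, and this is what
  Ekeland's principle will perform afterwards.  With \<open>\<xi>\<close> and \<open>\<eta>\<close> fixed the functional splits into
  a function of \<open>x\<close> and a function of \<open>y\<close>.\<close>

lemma near_maximizers:
  fixes C :: "'e::{real_inner, complete_space} graph" and U V :: "'e \<Rightarrow> real"
  assumes C: "m_dissipative C" and dense: "closure (Domain C) = UNIV"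
    and bdd: "\<And>x. U x \<le> K" "\<And>y. - V y \<le> K" and pos: "b0 > 0" "\<delta> > 0"
  obtains b \<epsilon> x0 \<xi> \<eta> y0 where "b \<ge> b0" "0 < \<epsilon>" "\<epsilon> \<le> \<delta>" "\<xi> \<in> Domain C" "\<eta> \<in> Domain C"
    "\<And>x y. U x0 - b / 2 * (norm (x0 - \<xi>))\<^sup>2 \<le> U x - b / 2 * (norm (x - \<xi>))\<^sup>2 \<Longrightarrow>
       - V y0 - b / 2 * (norm (y0 - \<eta>))\<^sup>2 \<le> - V y - b / 2 * (norm (y - \<eta>))\<^sup>2 \<Longrightarrow>
       (\<forall>z. U z - V z - 3 * \<delta> \<le> U x - V y) \<and>
       b * chain_sq x \<xi> \<eta> y + \<epsilon> * ((norm \<xi>)\<^sup>2 + (norm \<eta>)\<^sup>2) \<le> 16 * \<delta> \<and>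
       norm (residual b \<epsilon> x \<xi> \<eta>) \<le> \<epsilon> \<and> norm (residual b \<epsilon> y \<eta> \<xi>) \<le> \<epsilon> \<and>
       inner (residual b \<epsilon> x \<xi> \<eta>) (canonical_restriction C \<xi>) \<le> \<delta> \<and>
       inner (residual b \<epsilon> y \<eta> \<xi>) (canonical_restriction C \<eta>) \<le> \<delta>"
proof -
  obtain b m where b: "b \<ge> b0" and m: "\<And>x \<xi> \<eta> y. quadrupled U V b 0 x \<xi> \<eta> y \<le> m"
    and half: "\<And>x \<xi> \<eta> y. quadrupled U V (b / 2) 0 x \<xi> \<eta> y \<le> m + \<delta>"
    and "\<exists>x \<xi> \<eta> y. m - \<delta> < quadrupled U V b 0 x \<xi> \<eta> y"
    using penalty_level[of U K V, OF bdd pos] by blast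
  then obtain x1 \<xi>1 \<eta>1 y1 where pt1: "m - \<delta> < quadrupled U V b 0 x1 \<xi>1 \<eta>1 y1" by blast
  have "b > 0" using b pos by simp
  define N where "N = (norm \<xi>1)\<^sup>2 + (norm \<eta>1)\<^sup>2"
  \<comment> \<open>Small enough for the localisation to cost at most \<open>\<delta>\<close> at the point found above.\<close>
  define \<epsilon> where "\<epsilon> = min \<delta> (\<delta> / (N + 1))"
  have "N \<ge> 0" by (simp add: N_def)
  have \<epsilon>: "\<epsilon> > 0" "\<epsilon> \<le> \<delta>" using pos \<open>N \<ge> 0\<close> by (auto simp: \<epsilon>_def)
  have "\<epsilon> / 2 * N \<le> \<delta>"
  proof -
    have "\<epsilon> * (N + 1) \<le> \<delta> / (N + 1) * (N + 1)"
      using \<open>N \<ge> 0\<close> by (intro mult_right_mono) (auto simp: \<epsilon>_def)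
    also have "\<dots> = \<delta>" using \<open>N \<ge> 0\<close> by simp
    finally have "\<epsilon> * N \<le> \<delta>" using \<epsilon> by (simp add: distrib_left)
    moreover have "0 \<le> \<epsilon> * N" using \<epsilon> \<open>N \<ge> 0\<close> by simp
    ultimately show ?thesis by simp
  qed
  then have pt1': "m - 2 * \<delta> < quadrupled U V b \<epsilon> x1 \<xi>1 \<eta>1 y1"
    using pt1 by (simp add: quadrupled_def N_def)
  obtain M where M: "\<And>x \<xi> \<eta> y. quadrupled U V b \<epsilon> x \<xi> \<eta> y \<le> M"
    and nearM: "\<And>e. e > 0 \<Longrightarrow> \<exists>x \<xi> \<eta> y. M - e < quadrupled U V b \<epsilon> x \<xi> \<eta> y"
  proof -
    let ?q = "\<lambda>(x, \<xi>, \<eta>, y). quadrupled U V b \<epsilon> x \<xi> \<eta> y"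
    obtain M where "\<And>p. p \<in> UNIV \<Longrightarrow> ?q p \<le> M" "\<And>e. e > 0 \<Longrightarrow> \<exists>p\<in>UNIV. M - e < ?q p"
    proof (rule approx_sup[of UNIV ?q "2 * K"])
      show "?q p \<le> 2 * K" for p
        using quadrupled_le[of U K V b \<epsilon>, OF bdd] \<open>b > 0\<close> \<epsilon>(1) by (cases p) simp
    qed auto
    then show thesis by (intro that[of M]) auto
  qed
  have M_lower: "m - 2 * \<delta> < M" using pt1' M less_le_trans by blast
  \<comment> \<open>The second argument makes the residuals at most \<open>\<epsilon>\<close> in norm.\<close>
  define \<theta> where "\<theta> = min (\<delta> / 3) (\<epsilon>\<^sup>2 / (6 * (2 * b + \<epsilon>)))"
  have c: "2 * b + \<epsilon> > 0" using \<open>b > 0\<close> \<epsilon> by simp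
  have \<theta>: "\<theta> > 0" "3 * \<theta> \<le> \<delta>" using pos \<epsilon> c by (auto simp: \<theta>_def)
  have c\<theta>: "6 * (2 * b + \<epsilon>) * \<theta> \<le> \<epsilon>\<^sup>2"
  proof -
    have "6 * (2 * b + \<epsilon>) * \<theta> \<le> 6 * (2 * b + \<epsilon>) * (\<epsilon>\<^sup>2 / (6 * (2 * b + \<epsilon>)))"
      using c by (intro mult_left_mono) (auto simp: \<theta>_def)
    then show ?thesis using c by simp
  qed
  \<comment> \<open>By density and continuity, the supremum is nearly attained with \<open>\<xi>\<close> and \<open>\<eta>\<close> in the domain.\<close>
  obtain x2 \<xi>2 \<eta>2 y2 w2 \<omega>2 where pt2: "M - \<theta> < quadrupled U V b \<epsilon> x2 \<xi>2 \<eta>2 y2"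
    and "(\<xi>2, w2) \<in> C" "(\<eta>2, \<omega>2) \<in> C"
  proof -
    obtain x \<xi> \<eta> y where "M - \<theta> < quadrupled U V b \<epsilon> x \<xi> \<eta> y" using nearM[OF \<theta>(1)] by blast
    moreover have "open {\<zeta>. M - \<theta> < quadrupled U V b \<epsilon> x \<zeta> \<eta> y}"
      unfolding quadrupled_def chain_sq_def by (intro open_Collect_less continuous_intros)
    ultimately obtain \<xi>' where \<xi>': "\<xi>' \<in> Domain C" "M - \<theta> < quadrupled U V b \<epsilon> x \<xi>' \<eta> y"
      using dense_meets_open[OF dense, of _ \<xi>] by (metis (mono_tags, lifting) mem_Collect_eq)
    moreover have "open {\<zeta>. M - \<theta> < quadrupled U V b \<epsilon> x \<xi>' \<zeta> y}"
      unfolding quadrupled_def chain_sq_def by (intro open_Collect_less continuous_intros)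
    ultimately obtain \<eta>' where "\<eta>' \<in> Domain C" "M - \<theta> < quadrupled U V b \<epsilon> x \<xi>' \<eta>' y"
      using dense_meets_open[OF dense, of _ \<eta>] by (metis (mono_tags, lifting) mem_Collect_eq)
    then show thesis using \<xi>' that by blast
  qed
  define N2 where "N2 = (norm w2)\<^sup>2 + (norm \<omega>2)\<^sup>2"
  define \<kappa> where "\<kappa> = \<theta> / (N2 + 1)"
  have "N2 \<ge> 0" by (simp add: N2_def)
  have \<kappa>: "\<kappa> > 0" using \<theta> \<open>N2 \<ge> 0\<close> by (simp add: \<kappa>_def)
  have "\<kappa> / 2 * N2 \<le> \<theta>"
  proof -
    have "\<kappa> * (N2 + 1) = \<theta>" using \<open>N2 \<ge> 0\<close> by (simp add: \<kappa>_def)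
    moreover have "0 \<le> \<kappa> * N2" using \<kappa> \<open>N2 \<ge> 0\<close> by simp
    ultimately show ?thesis using \<kappa> by (simp add: distrib_left)
  qed
  define \<Psi> where "\<Psi> x \<xi> w \<eta> \<omega> y = quadrupled U V b \<epsilon> x \<xi> \<eta> y - \<kappa> / 2 * ((norm w)\<^sup>2 + (norm \<omega>)\<^sup>2)"
    for x \<xi> w \<eta> \<omega> y :: 'e
  have \<Psi>_le: "\<Psi> x \<xi> w \<eta> \<omega> y \<le> M" for x \<xi> w \<eta> \<omega> y
  proof -
    have "0 \<le> \<kappa> / 2 * ((norm w)\<^sup>2 + (norm \<omega>)\<^sup>2)" using \<kappa> by simp
    then show ?thesis using M[of x \<xi> \<eta> y] unfolding \<Psi>_def by linarith
  qed
  obtain M' where M': "\<And>x \<xi> w \<eta> \<omega> y. (\<xi>, w) \<in> C \<Longrightarrow> (\<eta>, \<omega>) \<in> C \<Longrightarrow> \<Psi> x \<xi> w \<eta> \<omega> y \<le> M'"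
    and nearM': "\<And>e. e > 0 \<Longrightarrow> \<exists>x \<xi> w \<eta> \<omega> y. (\<xi>, w) \<in> C \<and> (\<eta>, \<omega>) \<in> C \<and> M' - e < \<Psi> x \<xi> w \<eta> \<omega> y"
  proof -
    let ?q = "\<lambda>(x, (\<xi>, w), (\<eta>, \<omega>), y). \<Psi> x \<xi> w \<eta> \<omega> y"
    let ?S = "UNIV \<times> C \<times> C \<times> UNIV"
    obtain M' where 1: "\<And>p. p \<in> ?S \<Longrightarrow> ?q p \<le> M'" and 2: "\<And>e. e > 0 \<Longrightarrow> \<exists>p\<in>?S. M' - e < ?q p"
    proof (rule approx_sup[of ?S ?q M])
      show "?S \<noteq> {}" using \<open>(\<xi>2, w2) \<in> C\<close> by auto
    qed (auto simp: \<Psi>_le)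
    show thesis
    proof (rule that[of M'])
      show "\<Psi> x \<xi> w \<eta> \<omega> y \<le> M'" if "(\<xi>, w) \<in> C" "(\<eta>, \<omega>) \<in> C" for x \<xi> w \<eta> \<omega> y
        using 1[of "(x, (\<xi>, w), (\<eta>, \<omega>), y)"] that by simp
      show "\<exists>x \<xi> w \<eta> \<omega> y. (\<xi>, w) \<in> C \<and> (\<eta>, \<omega>) \<in> C \<and> M' - e < \<Psi> x \<xi> w \<eta> \<omega> y" if "e > 0" for e
        using 2[OF that] by fastforce
    qed
  qed
  have "M - 2 * \<theta> \<le> \<Psi> x2 \<xi>2 w2 \<eta>2 \<omega>2 y2"
    using pt2 \<open>\<kappa> / 2 * N2 \<le> \<theta>\<close> by (simp add: \<Psi>_def N2_def)
  also have "\<dots> \<le> M'" by (rule M') fact+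
  finally have M'_lower: "M - 2 * \<theta> \<le> M'" .
  \<comment> \<open>An a priori bound for the values of \<open>C\<close> at all near-maximisers.\<close>
  define W where "W = sqrt (6 * \<theta> / \<kappa>)"
  obtain r where r: "r > 0" "r\<^sup>2 \<le> \<theta>" and
    step: "(2 * b + \<epsilon>) * r * W\<^sup>2 / 2 + r
      + \<epsilon> * sqrt (2 / \<kappa> * (r * (\<epsilon> * W) + (2 * b + \<epsilon>) * r\<^sup>2 * W\<^sup>2 / 2 + r\<^sup>2)) \<le> \<delta>"
    using small_step[OF \<theta>(1) pos(2)] by blast
  obtain x0 \<xi> w \<eta> \<omega> y0 where \<xi>: "(\<xi>, w) \<in> C" and \<eta>: "(\<eta>, \<omega>) \<in> C"
    and pt3: "M' - r\<^sup>2 < \<Psi> x0 \<xi> w \<eta> \<omega> y0"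
    using nearM'[of "r\<^sup>2"] r(1) by (metis zero_less_power)
  show thesis
  proof (rule that[OF b \<epsilon>])
    show "\<xi> \<in> Domain C" "\<eta> \<in> Domain C" using \<xi> \<eta> by auto
    fix x y
    assume x: "U x0 - b / 2 * (norm (x0 - \<xi>))\<^sup>2 \<le> U x - b / 2 * (norm (x - \<xi>))\<^sup>2"
      and y: "- V y0 - b / 2 * (norm (y0 - \<eta>))\<^sup>2 \<le> - V y - b / 2 * (norm (y - \<eta>))\<^sup>2"
    define q where "q = quadrupled U V b \<epsilon> x \<xi> \<eta> y"
    have "quadrupled U V b \<epsilon> x0 \<xi> \<eta> y0 \<le> q"
      using x y unfolding q_def quadrupled_def chain_sq_def
      by (simp add: norm_minus_commute distrib_left)
    then have pt: "M' - r\<^sup>2 < q - \<kappa> / 2 * ((norm w)\<^sup>2 + (norm \<omega>)\<^sup>2)"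
      using pt3 unfolding \<Psi>_def by linarith
    have kw: "0 \<le> \<kappa> / 2 * (norm w)\<^sup>2" "0 \<le> \<kappa> / 2 * (norm \<omega>)\<^sup>2" using \<kappa> by simp_all
    have sum: "\<kappa> / 2 * ((norm w)\<^sup>2 + (norm \<omega>)\<^sup>2) = \<kappa> / 2 * (norm w)\<^sup>2 + \<kappa> / 2 * (norm \<omega>)\<^sup>2"
      by (simp add: distrib_left)
    have qM: "q \<le> M" unfolding q_def by (rule M)
    have q: "M - 3 * \<theta> \<le> q" using pt kw sum M'_lower r(2) by linarith
    then have qm: "m - 3 * \<delta> \<le> q" using M_lower \<theta>(2) by linarith
    have W: "norm v \<le> W" if "\<kappa> / 2 * (norm v)\<^sup>2 \<le> 3 * \<theta>" for v :: 'e
      unfolding W_def using that \<kappa> by (intro real_le_rsqrt) (simp add: field_simps)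
    have "norm w \<le> W" "norm \<omega> \<le> W"
      using pt kw sum M'_lower r(2) qM by (intro W; linarith)+
    have opt: "\<Psi> x' \<zeta> \<nu> \<zeta>' \<nu>' y' \<le> q - \<kappa> / 2 * ((norm w)\<^sup>2 + (norm \<omega>)\<^sup>2) + r\<^sup>2"
      if "(\<zeta>, \<nu>) \<in> C" "(\<zeta>', \<nu>') \<in> C" for x' \<zeta> \<nu> \<zeta>' \<nu>' y'
      using M'[OF that, of x' y'] pt by linarith
    let ?V = "\<lambda>z. - V z" and ?U = "\<lambda>z. - U z"
    have left: "norm (residual b \<epsilon> x \<xi> \<eta>) \<le> \<epsilon>"
      "inner (residual b \<epsilon> x \<xi> \<eta>) (canonical_restriction C \<xi>) \<le> \<delta>"
    proof -
      have "quadrupled U V b \<epsilon> x \<zeta> \<eta> y - \<kappa> / 2 * (norm \<nu>)\<^sup>2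
          \<le> quadrupled U V b \<epsilon> x \<xi> \<eta> y - \<kappa> / 2 * (norm w)\<^sup>2 + r\<^sup>2" if "(\<zeta>, \<nu>) \<in> C" for \<zeta> \<nu>
        using opt[OF that \<eta>, of x y] unfolding \<Psi>_def q_def by (simp add: distrib_left)
      from near_maximal_residual[OF C \<xi> \<open>b > 0\<close> \<epsilon>(1) \<kappa> r(1) M q[unfolded q_def] c\<theta> this
          \<open>norm w \<le> W\<close> step]
      show "norm (residual b \<epsilon> x \<xi> \<eta>) \<le> \<epsilon>"
        "inner (residual b \<epsilon> x \<xi> \<eta>) (canonical_restriction C \<xi>) \<le> \<delta>" by auto
    qed
    have right: "norm (residual b \<epsilon> y \<eta> \<xi>) \<le> \<epsilon>"
      "inner (residual b \<epsilon> y \<eta> \<xi>) (canonical_restriction C \<eta>) \<le> \<delta>"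
    proof -
      have M_swap: "quadrupled ?V ?U b \<epsilon> y \<zeta> \<xi> x \<le> M" for \<zeta>
        unfolding quadrupled_swap by (rule M)
      have q_swap: "M - 3 * \<theta> \<le> quadrupled ?V ?U b \<epsilon> y \<eta> \<xi> x"
        unfolding quadrupled_swap using q unfolding q_def .
      have "quadrupled ?V ?U b \<epsilon> y \<zeta> \<xi> x - \<kappa> / 2 * (norm \<nu>)\<^sup>2
          \<le> quadrupled ?V ?U b \<epsilon> y \<eta> \<xi> x - \<kappa> / 2 * (norm \<omega>)\<^sup>2 + r\<^sup>2" if "(\<zeta>, \<nu>) \<in> C" for \<zeta> \<nu>
        using opt[OF \<xi> that, of x y] unfolding \<Psi>_def q_def quadrupled_swap by (simp add: distrib_left)
      from near_maximal_residual[OF C \<eta> \<open>b > 0\<close> \<epsilon>(1) \<kappa> r(1) M_swap q_swap c\<theta> this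
          \<open>norm \<omega> \<le> W\<close> step]
      show "norm (residual b \<epsilon> y \<eta> \<xi>) \<le> \<epsilon>"
        "inner (residual b \<epsilon> y \<eta> \<xi>) (canonical_restriction C \<eta>) \<le> \<delta>" by auto
    qed
    let ?P = "chain_sq x \<xi> \<eta> y" and ?R = "(norm \<xi>)\<^sup>2 + (norm \<eta>)\<^sup>2"
    have nonneg: "0 \<le> b * ?P" "0 \<le> \<epsilon> * ?R"
      using \<open>b > 0\<close> \<epsilon>(1) by (simp_all add: chain_sq_def)
    have q_eq: "q = U x - V y - (b * ?P) / 2 - (\<epsilon> * ?R) / 2"
      by (simp add: q_def quadrupled_def)
    have Um: "U z - V z \<le> m" for z
      using m[of z z z z] by (simp add: quadrupled_def chain_sq_def)
    have val: "U z - V z - 3 * \<delta> \<le> U x - V y" for z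
      using Um[of z] qm q_eq nonneg by linarith
    have "U x - V y - (b * ?P) / 4 \<le> m + \<delta>"
      using half[of x \<xi> \<eta> y] by (simp add: quadrupled_def)
    then have "b * ?P + \<epsilon> * ?R \<le> 16 * \<delta>" using qm q_eq nonneg by linarith
    with left right val
    show "(\<forall>z. U z - V z - 3 * \<delta> \<le> U x - V y) \<and>
       b * ?P + \<epsilon> * ?R \<le> 16 * \<delta> \<and>
       norm (residual b \<epsilon> x \<xi> \<eta>) \<le> \<epsilon> \<and> norm (residual b \<epsilon> y \<eta> \<xi>) \<le> \<epsilon> \<and>
       inner (residual b \<epsilon> x \<xi> \<eta>) (canonical_restriction C \<xi>) \<le> \<delta> \<and>
       inner (residual b \<epsilon> y \<eta> \<xi>) (canonical_restriction C \<eta>) \<le> \<delta>"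
      by blast
  qed
qed

section \<open>The comparison principle\<close>

text \<open>Without the factor \<open>1 / \<theta>\<close> the quadratic parts would differ by a term of order \<open>T \<parallel>B\<^sup>* q\<parallel>\<close>, and
  \<open>\<parallel>B\<^sup>* q\<parallel>\<close> is not bounded uniformly in the penalty.  As \<open>\<theta> > 1\<close>, the inequality
  \<open>(A + e)\<^sup>2 \<le> \<theta> A\<^sup>2 + \<theta> / (\<theta> - 1) e\<^sup>2\<close> absorbs the mixed term.\<close>

lemma hamiltonian_gap:
  fixes F :: "'e::real_inner \<Rightarrow> 'e" and B :: "'e \<Rightarrow> 'u::{real_inner, complete_space} \<Rightarrow>\<^sub>L 'e"
  assumes \<theta>: "\<theta> > 1"
    and lip: "norm (F x - F y) \<le> L * norm (x - y)" "norm (B x - B y) \<le> L * norm (x - y)"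
    and T: "L * norm (x - y) * norm q + (norm (F x) + norm (B x)) * norm (p - q) \<le> T"
  shows "inner (F x) p + 1 / (2 * \<theta>) * (norm (adjoint (blinfun_apply (B x)) p))\<^sup>2 - hamiltonian F B y q
    \<le> T + T\<^sup>2 / (2 * (\<theta> - 1))"
proof -
  let ?P = "adjoint (blinfun_apply (B x)) p" and ?Q = "adjoint (blinfun_apply (B y)) q"
  define e where "e = norm (B x) * norm (p - q) + L * norm (x - y) * norm q"
  have Lq: "norm (F x - F y) * norm q \<le> L * norm (x - y) * norm q"
    "norm (B x - B y) * norm q \<le> L * norm (x - y) * norm q"
    using lip by (simp_all add: mult_right_mono)
  have nonneg: "0 \<le> norm (F x - F y) * norm q" "0 \<le> norm (F x) * norm (p - q)"
    "0 \<le> norm (B x) * norm (p - q)" by simp_all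
  have "0 \<le> e" using Lq(1) nonneg unfolding e_def by linarith
  have eT: "e \<le> T" using T nonneg(2) unfolding e_def distrib_right by linarith
  have "inner (F x) p - inner (F y) q = inner (F x) (p - q) + inner (F x - F y) q"
    by (simp add: inner_diff_left inner_diff_right)
  also have "\<dots> \<le> norm (F x) * norm (p - q) + norm (F x - F y) * norm q"
    by (intro add_mono norm_cauchy_schwarz)
  also have "\<dots> \<le> T" using Lq(1) T nonneg(3) unfolding distrib_right by linarith
  finally have drift: "inner (F x) p - inner (F y) q \<le> T" .
  have "norm ?P \<le> norm ?Q + norm (?P - ?Q)" by norm
  also have "norm (?P - ?Q) \<le> e"
    using norm_adjoint_diff_le[of "B x" p "B y" q] Lq(2) unfolding e_def by linarith
  finally have "(norm ?P)\<^sup>2 \<le> (norm ?Q + e)\<^sup>2" by (intro power_mono) auto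
  also have "\<dots> \<le> \<theta> * (norm ?Q)\<^sup>2 + \<theta> / (\<theta> - 1) * e\<^sup>2"
  proof -
    have "0 \<le> ((\<theta> - 1) * norm ?Q - e)\<^sup>2 / (\<theta> - 1)" using \<theta> by simp
    also have "\<dots> = (\<theta> - 1) * (norm ?Q)\<^sup>2 - 2 * norm ?Q * e + e\<^sup>2 / (\<theta> - 1)"
      using \<theta> by (simp add: field_simps power2_eq_square)
    finally have "2 * norm ?Q * e \<le> (\<theta> - 1) * (norm ?Q)\<^sup>2 + e\<^sup>2 / (\<theta> - 1)" by simp
    moreover have "\<theta> / (\<theta> - 1) * e\<^sup>2 = e\<^sup>2 + e\<^sup>2 / (\<theta> - 1)" using \<theta> by (simp add: field_simps)
    ultimately show ?thesis by (simp add: power2_sum algebra_simps)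
  qed
  finally have "1 / (2 * \<theta>) * (norm ?P)\<^sup>2 \<le> 1 / (2 * \<theta>) * (\<theta> * (norm ?Q)\<^sup>2 + \<theta> / (\<theta> - 1) * e\<^sup>2)"
    using \<theta> by (intro mult_left_mono) auto
  also have "\<dots> = 1 / 2 * (norm ?Q)\<^sup>2 + e\<^sup>2 / (2 * (\<theta> - 1))"
    using \<theta> by (simp add: distrib_left)
  also have "e\<^sup>2 / (2 * (\<theta> - 1)) \<le> T\<^sup>2 / (2 * (\<theta> - 1))"
    using \<theta> eT \<open>0 \<le> e\<close> by (intro divide_right_mono power_mono) auto
  finally show ?thesis using drift by (simp add: hamiltonian_def)
qed

text \<open>The momenta of the two test functions are \<open>b (x - \<xi>)\<close> and \<open>b (\<eta> - y)\<close>.  Their difference is the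
  sum of the two residuals and \<open>\<epsilon> (\<xi> + \<eta>)\<close>.  All errors are therefore products controlled by the
  penalty: \<open>b\<close> times squares of links of the chain, or \<open>\<epsilon>\<close> times squares of \<open>\<xi>\<close> and \<open>\<eta>\<close>, up
  to terms of order \<open>\<epsilon>\<close>.\<close>

lemma doubling_error:
  fixes x y \<xi> \<eta> :: "'e::real_inner"
  assumes b: "b \<ge> 1" and \<epsilon>: "0 < \<epsilon>" "\<epsilon> \<le> \<delta>" "\<delta> \<le> 1"
    and pen: "b * chain_sq x \<xi> \<eta> y + \<epsilon> * ((norm \<xi>)\<^sup>2 + (norm \<eta>)\<^sup>2) \<le> 16 * \<delta>"
    and res: "norm (residual b \<epsilon> x \<xi> \<eta>) \<le> \<epsilon>" "norm (residual b \<epsilon> y \<eta> \<xi>) \<le> \<epsilon>"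
  shows "norm (x - y) * norm (b *\<^sub>R (\<eta> - y)) \<le> 32 * \<delta>"
    and "(1 + norm x) * norm (b *\<^sub>R (x - \<xi>) - b *\<^sub>R (\<eta> - y)) \<le> 56 * \<delta>"
    and "(norm (x - y))\<^sup>2 \<le> 48 / b"
    and "norm x \<le> 5 + 16 / \<epsilon>" "norm y \<le> 5 + 16 / \<epsilon>"
    and "norm (b *\<^sub>R (x - \<xi>)) \<le> 4 * b" "norm (b *\<^sub>R (\<eta> - y)) \<le> 4 * b"
proof -
  define a1 a2 a3 t1 t2 where "a1 = norm (x - \<xi>)" and "a2 = norm (\<xi> - \<eta>)" and "a3 = norm (\<eta> - y)"
    and "t1 = norm \<xi>" and "t2 = norm \<eta>"
  note a_defs = a1_def a2_def a3_def t1_def t2_def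
  have nn: "0 \<le> a1" "0 \<le> a2" "0 \<le> a3" "0 \<le> t1" "0 \<le> t2" by (simp_all add: a_defs)
  define P where "P = a1\<^sup>2 + a2\<^sup>2 + a3\<^sup>2"
  define Q where "Q = t1\<^sup>2 + t2\<^sup>2"
  have pen: "b * P + \<epsilon> * Q \<le> 16 * \<delta>" using pen by (simp add: P_def Q_def a_defs chain_sq_def)
  have PQ: "0 \<le> P" "0 \<le> Q" by (simp_all add: P_def Q_def)
  have bP: "b * P \<le> 16 * \<delta>" and \<epsilon>Q: "\<epsilon> * Q \<le> 16 * \<delta>"
    using pen PQ b \<epsilon> mult_nonneg_nonneg[of b P] mult_nonneg_nonneg[of \<epsilon> Q] by linarith+
  have xy: "norm (x - y) \<le> a1 + a2 + a3" unfolding a_defs by norm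
  have am_gm: "2 * (s * t) \<le> s\<^sup>2 + t\<^sup>2" for s t :: real
    using sum_squares_bound[of s t] by (simp add: mult.assoc)
  have "norm (x - y) * norm (b *\<^sub>R (\<eta> - y)) = b * (norm (x - y) * a3)"
    using b by (simp add: a_defs)
  also have "\<dots> \<le> b * (2 * P)"
  proof -
    have "norm (x - y) * a3 \<le> (a1 + a2 + a3) * a3" using xy nn by (intro mult_right_mono)
    also have "\<dots> \<le> 2 * P"
      using am_gm[of a1 a3] am_gm[of a2 a3] zero_le_power2[of a1] zero_le_power2[of a2]
      unfolding P_def distrib_right power2_eq_square by argo
    finally show ?thesis using b by (intro mult_left_mono) auto
  qed
  also have "\<dots> \<le> 32 * \<delta>" using bP by argo
  finally show "norm (x - y) * norm (b *\<^sub>R (\<eta> - y)) \<le> 32 * \<delta>" .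
  have P16: "P \<le> 16"
    using bP mult_right_mono[OF b PQ(1)] \<epsilon> by simp
  have small: "s \<le> 4" if "s\<^sup>2 \<le> P" "0 \<le> s" for s
  proof (rule power2_le_imp_le)
    show "s\<^sup>2 \<le> 4\<^sup>2" using that P16 by simp
  qed simp
  have a4: "a1 \<le> 4" "a3 \<le> 4" using nn by (auto intro!: small simp: P_def)
  have tQ: "t \<le> 1 + Q" if "t\<^sup>2 \<le> Q" for t
    using am_gm[of t 1] that PQ by simp
  have "Q \<le> 16 / \<epsilon>" using \<epsilon>Q \<epsilon> by (simp add: pos_le_divide_eq mult.commute)
  moreover have "t1\<^sup>2 \<le> Q" "t2\<^sup>2 \<le> Q" by (simp_all add: Q_def)
  ultimately have t: "t1 \<le> 1 + 16 / \<epsilon>" "t2 \<le> 1 + 16 / \<epsilon>"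
    using tQ[of t1] tQ[of t2] by linarith+
  have x: "norm x \<le> t1 + a1" unfolding a_defs by norm
  have y: "norm y \<le> t2 + a3" unfolding a_defs by norm
  show "norm x \<le> 5 + 16 / \<epsilon>" "norm y \<le> 5 + 16 / \<epsilon>" using x y t a4 by linarith+
  show "norm (b *\<^sub>R (x - \<xi>)) \<le> 4 * b" "norm (b *\<^sub>R (\<eta> - y)) \<le> 4 * b"
    using a4 b by (simp_all add: a_defs mult.commute)
  have "(norm (x - y))\<^sup>2 \<le> (a1 + a2 + a3)\<^sup>2" using xy by (intro power_mono) auto
  also have "\<dots> \<le> 3 * P"
    using am_gm[of a1 a2] am_gm[of a1 a3] am_gm[of a2 a3] unfolding P_def
    by (simp add: power2_eq_square algebra_simps)
  also have "\<dots> \<le> 48 / b" using bP b \<epsilon> by (simp add: field_simps)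
  finally show "(norm (x - y))\<^sup>2 \<le> 48 / b" .
  have "b *\<^sub>R (x - \<xi>) - b *\<^sub>R (\<eta> - y) = residual b \<epsilon> x \<xi> \<eta> + residual b \<epsilon> y \<eta> \<xi> + \<epsilon> *\<^sub>R (\<xi> + \<eta>)"
    by (simp add: residual_def algebra_simps)
  moreover have "norm (\<epsilon> *\<^sub>R (\<xi> + \<eta>)) \<le> \<epsilon> * (t1 + t2)"
    using \<epsilon> norm_triangle_ineq[of \<xi> \<eta>] by (simp add: a_defs)
  ultimately have "norm (b *\<^sub>R (x - \<xi>) - b *\<^sub>R (\<eta> - y)) \<le> \<epsilon> + \<epsilon> + \<epsilon> * (t1 + t2)"
    using res norm_triangle_ineq[of "residual b \<epsilon> x \<xi> \<eta>" "residual b \<epsilon> y \<eta> \<xi>"]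
      norm_triangle_ineq[of "residual b \<epsilon> x \<xi> \<eta> + residual b \<epsilon> y \<eta> \<xi>" "\<epsilon> *\<^sub>R (\<xi> + \<eta>)"]
    by simp
  also have "\<dots> = \<epsilon> * (2 + t1 + t2)" by (simp add: algebra_simps)
  finally have "(1 + norm x) * norm (b *\<^sub>R (x - \<xi>) - b *\<^sub>R (\<eta> - y)) \<le> (1 + t1 + a1) * (\<epsilon> * (2 + t1 + t2))"
    using x nn by (intro mult_mono) auto
  also have "\<dots> = \<epsilon> * ((1 + t1 + a1) * (2 + t1 + t2))" by simp
  also have "\<dots> \<le> \<epsilon> * (8 + 3 * Q + 2 * P)"
  proof (intro mult_left_mono)
    have "(1 + t1 + a1) * (2 + t1 + t2)
        = 2 + 3 * t1 + t2 + 2 * a1 + t1\<^sup>2 + t1 * t2 + a1 * t1 + a1 * t2"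
      by (simp add: power2_eq_square algebra_simps)
    moreover have "3 * t1 \<le> t1\<^sup>2 + 9 / 4" "2 * t2 \<le> t2\<^sup>2 + 1" "2 * a1 \<le> a1\<^sup>2 + 1"
      using am_gm[of t1 "3 / 2"] am_gm[of t2 1] am_gm[of a1 1] by (simp_all add: power2_eq_square)
    ultimately have "(1 + t1 + a1) * (2 + t1 + t2) \<le> 8 + 3 * t1\<^sup>2 + 3 * t2\<^sup>2 + 2 * a1\<^sup>2"
      using am_gm[of t1 t2] am_gm[of a1 t1] am_gm[of a1 t2] zero_le_power2[of t2] by linarith
    then show "(1 + t1 + a1) * (2 + t1 + t2) \<le> 8 + 3 * Q + 2 * P"
      unfolding P_def Q_def distrib_left using zero_le_power2[of a2] zero_le_power2[of a3] by linarith
  qed (use \<epsilon> in simp)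
  also have "\<dots> = 8 * \<epsilon> + 3 * (\<epsilon> * Q) + 2 * (\<epsilon> * P)" by (simp add: algebra_simps)
  also have "\<dots> \<le> 8 * \<delta> + 3 * (\<epsilon> * Q) + 3 * (b * P)"
  proof -
    have "\<epsilon> * P \<le> b * P" using \<epsilon> b PQ by (intro mult_right_mono) auto
    moreover have "0 \<le> b * P" using b PQ by simp
    ultimately show ?thesis using \<epsilon> by linarith
  qed
  also have "\<dots> \<le> 56 * \<delta>" using pen by linarith
  finally show "(1 + norm x) * norm (b *\<^sub>R (x - \<xi>) - b *\<^sub>R (\<eta> - y)) \<le> 56 * \<delta>" .
qed

lemma momentum_modulus_le:
  assumes "0 \<le> \<rho>" "\<rho> \<le> 1" "norm (F x) \<le> G" "norm (B x) \<le> G" "norm p \<le> N"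
  shows "momentum_modulus F B \<rho> x p \<le> \<rho> * (G + G\<^sup>2 * (N + 1))"
proof -
  have "(norm (B x))\<^sup>2 * (norm p + \<rho>) \<le> G\<^sup>2 * (N + 1)"
  proof (rule mult_mono)
    show "(norm (B x))\<^sup>2 \<le> G\<^sup>2" using assms(4) by (rule power_mono) simp
    show "norm p + \<rho> \<le> N + 1" using assms(2,5) by linarith
  qed (use assms(1) in simp_all)
  then show ?thesis
    unfolding momentum_modulus_def using assms(1,3) by (intro mult_left_mono add_mono)
qed

text \<open>Up to the residuals, \<open>b (x - \<xi>)\<close> is \<open>b (\<xi> - \<eta>) + \<epsilon> \<xi>\<close> and \<open>b (y - \<eta>)\<close> is
  \<open>b (\<eta> - \<xi>) + \<epsilon> \<eta>\<close>.  The first parts combine to \<open>b \<langle>\<xi> - \<eta>, C\<^sup>0 \<xi> - C\<^sup>0 \<eta>\<rangle> \<le> 0\<close>, and the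
  terms with \<open>\<epsilon>\<close> are nonpositive by dissipativity against \<open>(0, 0)\<close>.\<close>

lemma canonical_drift_le:
  fixes C :: "'e::{real_inner, complete_space} graph"
  assumes C: "m_dissipative C" and zero: "(0, 0) \<in> C"
    and dom: "\<xi> \<in> Domain C" "\<eta> \<in> Domain C" and pos: "b \<ge> 0" "\<epsilon> \<ge> 0"
    and res: "inner (residual b \<epsilon> x \<xi> \<eta>) (canonical_restriction C \<xi>) \<le> \<delta>"
      "inner (residual b \<epsilon> y \<eta> \<xi>) (canonical_restriction C \<eta>) \<le> \<delta>"
  shows "b * inner (x - \<xi>) (canonical_restriction C \<xi>) + b * inner (y - \<eta>) (canonical_restriction C \<eta>) \<le> 2 * \<delta>"
proof -
  define v w where "v = canonical_restriction C \<xi>" and "w = canonical_restriction C \<eta>"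
  have vw: "(\<xi>, v) \<in> C" "(\<eta>, w) \<in> C"
    unfolding v_def w_def using canonical_restriction_in[OF C] dom by auto
  have "inner \<xi> v \<le> 0" "inner \<eta> w \<le> 0" "inner (\<xi> - \<eta>) (v - w) \<le> 0"
    using dissipative[OF C vw(1) zero] dissipative[OF C vw(2) zero] dissipative[OF C vw] by simp_all
  then have "\<epsilon> * inner \<xi> v \<le> 0" "\<epsilon> * inner \<eta> w \<le> 0" "b * inner (\<xi> - \<eta>) (v - w) \<le> 0"
    using pos by (simp_all add: mult_nonneg_nonpos)
  moreover have "b * inner (x - \<xi>) v = inner (residual b \<epsilon> x \<xi> \<eta>) v + b * inner (\<xi> - \<eta>) v + \<epsilon> * inner \<xi> v"
    "b * inner (y - \<eta>) w = inner (residual b \<epsilon> y \<eta> \<xi>) w + b * inner (\<eta> - \<xi>) w + \<epsilon> * inner \<eta> w"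
    by (simp_all add: residual_def inner_diff_left)
  moreover have "b * inner (\<xi> - \<eta>) (v - w) = b * inner (\<xi> - \<eta>) v + b * inner (\<eta> - \<xi>) w"
    by (simp add: inner_diff_left inner_diff_right algebra_simps)
  ultimately show ?thesis using res unfolding v_def[symmetric] w_def[symmetric] by linarith
qed

lemma lipschitz_pair:
  fixes F :: "'a::real_normed_vector \<Rightarrow> 'b::real_normed_vector" and B :: "'a \<Rightarrow> 'c::real_normed_vector"
  assumes "bdd_above {(norm (F x - F y) + norm (B x - B y)) / norm (x - y) | x y. x \<noteq> y}"
  obtains L where "L \<ge> 0" "\<And>x y. norm (F x - F y) \<le> L * norm (x - y)"
    "\<And>x y. norm (B x - B y) \<le> L * norm (x - y)"
proof -
  obtain L where L: "\<And>x y. x \<noteq> y \<Longrightarrow> (norm (F x - F y) + norm (B x - B y)) / norm (x - y) \<le> L"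
    using assms unfolding bdd_above_def by blast
  have "norm (F x - F y) + norm (B x - B y) \<le> max L 0 * norm (x - y)" for x y
  proof (cases "x = y")
    case False
    then have "norm (F x - F y) + norm (B x - B y) \<le> L * norm (x - y)"
      using L[OF False] by (simp add: divide_le_eq)
    also have "\<dots> \<le> max L 0 * norm (x - y)" by (intro mult_right_mono) auto
    finally show ?thesis .
  qed simp
  then have "norm (F x - F y) \<le> max L 0 * norm (x - y)" "norm (B x - B y) \<le> max L 0 * norm (x - y)" for x y
    using norm_ge_zero[of "F x - F y"] norm_ge_zero[of "B x - B y"] by (smt (verit))+
  then show thesis by (intro that[of "max L 0"]) auto
qed

lemma linear_growth:
  fixes F :: "'a::real_normed_vector \<Rightarrow> 'b::real_normed_vector" and B :: "'a \<Rightarrow> 'c::real_normed_vector"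
  assumes "L \<ge> 0" "\<And>x y. norm (F x - F y) \<le> L * norm (x - y)" "\<And>x y. norm (B x - B y) \<le> L * norm (x - y)"
  shows "norm (F x) + norm (B x) \<le> (norm (F 0) + norm (B 0) + 2 * L) * (1 + norm x)"
proof -
  have "norm (F x) \<le> norm (F 0) + L * norm x" "norm (B x) \<le> norm (B 0) + L * norm x"
    using assms(2)[of x 0] assms(3)[of x 0] norm_triangle_sub[of "F x" "F 0"] norm_triangle_sub[of "B x" "B 0"]
    by simp_all
  moreover have "0 \<le> norm (F 0) * norm x" "0 \<le> norm (B 0) * norm x" by simp_all
  moreover have "(norm (F 0) + norm (B 0) + 2 * L) * (1 + norm x)
      = norm (F 0) + norm (B 0) + 2 * L + norm (F 0) * norm x + norm (B 0) * norm x + 2 * (L * norm x)"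
    by (simp add: algebra_simps)
  ultimately show ?thesis using assms(1) by linarith
qed

lemma lipschitz_isCont:
  fixes f :: "'a::real_normed_vector \<Rightarrow> 'b::real_normed_vector"
  assumes "L \<ge> 0" "\<And>x y. norm (f x - f y) \<le> L * norm (x - y)"
  shows "isCont f x"
proof -
  have "L-lipschitz_on UNIV f" by (rule lipschitz_onI) (simp_all add: dist_norm assms)
  then have "continuous_on UNIV f" by (rule lipschitz_on_continuous_on)
  then show ?thesis by (simp add: continuous_on_eq_continuous_at)
qed

theorem theorem5p1:
  fixes C :: "('e::{real_inner, polish_space} \<times> 'e) set"
    and F :: "'e \<Rightarrow> 'e"
    and B :: "'e \<Rightarrow> 'u::{real_inner, polish_space} \<Rightarrow>\<^sub>L 'e"
    and \<alpha> :: real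
    and h fsub fsuper :: "'e \<Rightarrow> real"
  assumes "m_dissipative C"
    and "closure (Domain C) = UNIV"
    and "(0, 0) \<in> C"
    and "bdd_above {(norm (F x - F y) + norm (B x - B y)) / norm (x - y) | x y. x \<noteq> y}"
    and "\<alpha> > 0"
    and "bounded (range h)"
    and "uniformly_continuous_on UNIV h"
    and "viscosity_subsolution (H0 C F B) \<alpha> h fsub"
    and "viscosity_supersolution (H1 C F B) \<alpha> h fsuper"
  shows "\<forall>x. fsub x \<le> fsuper x"
proof (rule ccontr)
  note C = assms(1) and dense = assms(2) and zero = assms(3) and \<alpha> = assms(5)
    and sub = assms(8) and super = assms(9)
  assume "\<not> ?thesis"
  then obtain z where "fsuper z < fsub z" by (auto simp: not_le)
  define gap where "gap = fsub z - fsuper z"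
  have gap: "gap > 0" using \<open>fsuper z < fsub z\<close> by (simp add: gap_def)
  obtain L where L: "L \<ge> 0" "\<And>x y. norm (F x - F y) \<le> L * norm (x - y)"
    "\<And>x y. norm (B x - B y) \<le> L * norm (x - y)"
    using lipschitz_pair[OF assms(4)] by blast
  define G where "G = norm (F 0) + norm (B 0) + 2 * L"
  have "G \<ge> 0" using L(1) by (simp add: G_def)
  have growth: "norm (F x) + norm (B x) \<le> G * (1 + norm x)" for x
    unfolding G_def by (rule linear_growth) (use L in auto)
  have "isCont F x" "isCont B x" for x
    using lipschitz_isCont L by blast+
  note cont = this
  obtain K where K: "K \<ge> 0" "\<And>x. \<bar>fsub x\<bar> \<le> K" "\<And>x. \<bar>fsuper x\<bar> \<le> K" "\<And>x. \<bar>h x\<bar> \<le> K"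
  proof -
    have "bounded (range fsub \<union> range fsuper \<union> range h)"
      using assms(6) sub super by (auto simp: viscosity_subsolution_def viscosity_supersolution_def)
    then obtain K where "\<And>a. a \<in> range fsub \<union> range fsuper \<union> range h \<Longrightarrow> \<bar>a\<bar> \<le> K"
      unfolding bounded_iff real_norm_def by blast
    then have "\<bar>fsub x\<bar> \<le> K \<and> \<bar>fsuper x\<bar> \<le> K \<and> \<bar>h x\<bar> \<le> K" for x by blast
    moreover from this[of 0] have "K \<ge> 0" by linarith
    ultimately show thesis using that by blast
  qed
  \<comment> \<open>Passing from \<open>fsub\<close> to \<open>\<theta> fsub\<close> changes its values by at most a quarter of the gap.\<close>
  define \<theta> where "\<theta> = 1 + gap / (4 * (K + 1))"
  have \<theta>: "\<theta> > 1" using gap K(1) by (simp add: \<theta>_def)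
  have \<theta>K: "(\<theta> - 1) * K \<le> gap / 4"
  proof -
    have "(\<theta> - 1) * K \<le> (\<theta> - 1) * (K + 1)" using \<theta> by (intro mult_left_mono) auto
    also have "\<dots> = gap / 4" using K(1) by (simp add: \<theta>_def field_simps)
    finally show ?thesis .
  qed
  define T0 where "T0 = 32 * L + 56 * G"
  have "T0 \<ge> 0" using L(1) \<open>G \<ge> 0\<close> by (simp add: T0_def)
  \<comment> \<open>\<open>Y \<delta>\<close> collects all errors of the comparison that are linear in \<open>\<delta>\<close>.\<close>
  define Y where "Y = 5 + \<alpha> * (4 + T0 + T0\<^sup>2 / (2 * (\<theta> - 1)))"
  have "0 \<le> \<alpha> * (4 + T0 + T0\<^sup>2 / (2 * (\<theta> - 1)))"
    using \<alpha> \<open>T0 \<ge> 0\<close> \<theta> by simp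
  then have Y: "Y > 0" by (simp add: Y_def)
  define \<delta> where "\<delta> = min 1 (gap / (4 * Y))"
  have \<delta>: "\<delta> > 0" "\<delta> \<le> 1" using gap Y by (auto simp: \<delta>_def)
  have \<delta>Y: "\<delta> * Y \<le> gap / 4"
    using mult_right_mono[of \<delta> "gap / (4 * Y)" Y] Y by (simp add: \<delta>_def)
  obtain d where d: "d > 0" "\<And>x y. dist x y < d \<Longrightarrow> dist (h x) (h y) < gap / 8"
    using assms(7) gap unfolding uniformly_continuous_on_def
    by (metis UNIV_I zero_less_divide_iff zero_less_numeral)
  \<comment> \<open>Since \<open>\<parallel>x - y\<parallel>\<^sup>2 \<le> 48 / b\<close> at the points found below, they are closer than \<open>d\<close>.\<close>
  define b0 where "b0 = max 1 (49 / d\<^sup>2)"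
  have "b0 > 0" by (simp add: b0_def)
  have bnd: "\<theta> * fsub x \<le> \<theta> * K" "- fsuper x \<le> \<theta> * K" for x
  proof -
    show "\<theta> * fsub x \<le> \<theta> * K" using K(2)[of x] \<theta> by (intro mult_left_mono) auto
    have "K \<le> \<theta> * K" using K(1) \<theta> mult_right_mono[of 1 \<theta> K] by simp
    then show "- fsuper x \<le> \<theta> * K" using K(3)[of x] by linarith
  qed
  obtain b \<epsilon> x0 \<xi> \<eta> y0 where b: "b \<ge> b0" and \<epsilon>: "0 < \<epsilon>" "\<epsilon> \<le> \<delta>"
    and \<xi>: "\<xi> \<in> Domain C" and \<eta>: "\<eta> \<in> Domain C"
    and near: "\<And>x y. \<theta> * fsub x0 - b / 2 * (norm (x0 - \<xi>))\<^sup>2 \<le> \<theta> * fsub x - b / 2 * (norm (x - \<xi>))\<^sup>2 \<Longrightarrow>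
       - fsuper y0 - b / 2 * (norm (y0 - \<eta>))\<^sup>2 \<le> - fsuper y - b / 2 * (norm (y - \<eta>))\<^sup>2 \<Longrightarrow>
       (\<forall>z. \<theta> * fsub z - fsuper z - 3 * \<delta> \<le> \<theta> * fsub x - fsuper y) \<and>
       b * chain_sq x \<xi> \<eta> y + \<epsilon> * ((norm \<xi>)\<^sup>2 + (norm \<eta>)\<^sup>2) \<le> 16 * \<delta> \<and>
       norm (residual b \<epsilon> x \<xi> \<eta>) \<le> \<epsilon> \<and> norm (residual b \<epsilon> y \<eta> \<xi>) \<le> \<epsilon> \<and>
       inner (residual b \<epsilon> x \<xi> \<eta>) (canonical_restriction C \<xi>) \<le> \<delta> \<and>
       inner (residual b \<epsilon> y \<eta> \<xi>) (canonical_restriction C \<eta>) \<le> \<delta>"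
    by (rule near_maximizers[where U = "\<lambda>x. \<theta> * fsub x" and V = fsuper,
          OF C dense bnd \<open>b0 > 0\<close> \<delta>(1)]) (rule that)
  have b1: "b \<ge> 1" and bd: "49 / d\<^sup>2 \<le> b" using b by (auto simp: b0_def)
  \<comment> \<open>A bound for \<open>F\<close> and \<open>B\<close> on the ball that contains \<open>x\<close> and \<open>y\<close>; it makes \<open>\<rho>\<close> depend on \<open>b\<close> and \<open>\<epsilon>\<close> only.\<close>
  define R where "R = G * (6 + 16 / \<epsilon>)"
  have "R \<ge> 0" using \<open>G \<ge> 0\<close> \<epsilon> by (simp add: R_def)
  define Z where "Z = 1 + (R + R\<^sup>2 * (4 * b + 1))"
  have "Z \<ge> 1" using \<open>R \<ge> 0\<close> b1 by (simp add: Z_def)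
  define \<rho> where "\<rho> = \<delta> / Z"
  have \<rho>: "\<rho> > 0" "\<rho> \<le> 1" and \<rho>Z: "\<rho> * Z = \<delta>"
    using \<delta> \<open>Z \<ge> 1\<close> by (auto simp: \<rho>_def divide_le_eq)
  have "b > 0" using b1 by simp
  obtain x where x: "\<theta> * fsub x0 - b / 2 * (norm (x0 - \<xi>))\<^sup>2 \<le> \<theta> * fsub x - b / 2 * (norm (x - \<xi>))\<^sup>2"
    and sub_x: "inverse \<alpha> * (\<theta> * (fsub x - h x)) \<le> b * inner (x - \<xi>) (canonical_restriction C \<xi>)
      + inner (F x) (b *\<^sub>R (x - \<xi>)) + 1 / (2 * \<theta>) * (norm (adjoint (blinfun_apply (B x)) (b *\<^sub>R (x - \<xi>))))\<^sup>2
      + (\<rho> + momentum_modulus F B \<rho> x (b *\<^sub>R (x - \<xi>)))"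
    using subsolution_near[OF C dense cont sub \<open>b > 0\<close> \<rho>(1) less_imp_le[OF \<theta>] \<xi>] by metis
  obtain y where y: "- fsuper y0 - b / 2 * (norm (y0 - \<eta>))\<^sup>2 \<le> - fsuper y - b / 2 * (norm (y - \<eta>))\<^sup>2"
    and super_y: "inverse \<alpha> * (fsuper y - h y) \<ge> - b * inner (y - \<eta>) (canonical_restriction C \<eta>)
      + hamiltonian F B y (b *\<^sub>R (\<eta> - y)) - (\<rho> + momentum_modulus F B \<rho> y (b *\<^sub>R (\<eta> - y)))"
    using supersolution_near[OF C dense cont super \<open>b > 0\<close> \<rho>(1) \<eta>] by metis
  define p q where "p = b *\<^sub>R (x - \<xi>)" and "q = b *\<^sub>R (\<eta> - y)"
  from near[OF x y] have val: "\<theta> * fsub z - fsuper z - 3 * \<delta> \<le> \<theta> * fsub x - fsuper y"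
    and pen: "b * chain_sq x \<xi> \<eta> y + \<epsilon> * ((norm \<xi>)\<^sup>2 + (norm \<eta>)\<^sup>2) \<le> 16 * \<delta>"
    and res: "norm (residual b \<epsilon> x \<xi> \<eta>) \<le> \<epsilon>" "norm (residual b \<epsilon> y \<eta> \<xi>) \<le> \<epsilon>"
    and res_C: "inner (residual b \<epsilon> x \<xi> \<eta>) (canonical_restriction C \<xi>) \<le> \<delta>"
      "inner (residual b \<epsilon> y \<eta> \<xi>) (canonical_restriction C \<eta>) \<le> \<delta>"
    by auto
  note err = doubling_error[OF b1 \<epsilon> \<delta>(2) pen res, folded p_def q_def]
  have perturb: "\<rho> + momentum_modulus F B \<rho> x' p' \<le> \<delta>"
    if "norm x' \<le> 5 + 16 / \<epsilon>" "norm p' \<le> 4 * b" for x' p'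
  proof -
    have "norm (F x') + norm (B x') \<le> R"
      using growth[of x'] mult_left_mono[of "1 + norm x'" "6 + 16 / \<epsilon>" G] that(1) \<open>G \<ge> 0\<close>
      unfolding R_def by linarith
    then have "norm (F x') \<le> R" "norm (B x') \<le> R"
      using norm_ge_zero[of "F x'"] norm_ge_zero[of "B x'"] by linarith+
    then have "momentum_modulus F B \<rho> x' p' \<le> \<rho> * (R + R\<^sup>2 * (4 * b + 1))"
      using \<rho> that(2) by (intro momentum_modulus_le) auto
    then show ?thesis using \<rho>Z by (simp add: Z_def distrib_left)
  qed
  have drift: "b * inner (x - \<xi>) (canonical_restriction C \<xi>) + b * inner (y - \<eta>) (canonical_restriction C \<eta>) \<le> 2 * \<delta>"
    by (rule canonical_drift_le[OF C zero \<xi> \<eta> less_imp_le[OF \<open>b > 0\<close>] less_imp_le[OF \<epsilon>(1)] res_C])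
  have "L * norm (x - y) * norm q + (norm (F x) + norm (B x)) * norm (p - q) \<le> T0 * \<delta>"
  proof -
    have "L * (norm (x - y) * norm q) \<le> L * (32 * \<delta>)"
      using err(1) L(1) by (intro mult_left_mono)
    moreover have "(norm (F x) + norm (B x)) * norm (p - q) \<le> (G * (1 + norm x)) * norm (p - q)"
      by (intro mult_right_mono growth) simp
    moreover have "G * ((1 + norm x) * norm (p - q)) \<le> G * (56 * \<delta>)"
      using err(2) \<open>G \<ge> 0\<close> by (intro mult_left_mono)
    ultimately show ?thesis by (simp add: T0_def algebra_simps)
  qed
  from hamiltonian_gap[OF \<theta> L(2,3) this]
  have ham: "inner (F x) p + 1 / (2 * \<theta>) * (norm (adjoint (blinfun_apply (B x)) p))\<^sup>2 - hamiltonian F B y q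
    \<le> T0 * \<delta> + (T0 * \<delta>)\<^sup>2 / (2 * (\<theta> - 1))" .
  also have "(T0 * \<delta>)\<^sup>2 / (2 * (\<theta> - 1)) \<le> \<delta> * (T0\<^sup>2 / (2 * (\<theta> - 1)))"
  proof -
    have "\<delta>\<^sup>2 \<le> \<delta>" using \<delta> by (simp add: power2_eq_square mult_left_le)
    then have "\<delta>\<^sup>2 * (T0\<^sup>2 / (2 * (\<theta> - 1))) \<le> \<delta> * (T0\<^sup>2 / (2 * (\<theta> - 1)))"
      using \<theta> by (intro mult_right_mono) auto
    then show ?thesis by (simp add: power_mult_distrib mult.commute)
  qed
  finally have ham: "inner (F x) p + 1 / (2 * \<theta>) * (norm (adjoint (blinfun_apply (B x)) p))\<^sup>2 - hamiltonian F B y q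
    \<le> \<delta> * (T0 + T0\<^sup>2 / (2 * (\<theta> - 1)))"
    by (simp add: algebra_simps)
  have "inverse \<alpha> * (\<theta> * (fsub x - h x) - (fsuper y - h y)) \<le> \<delta> * (4 + T0 + T0\<^sup>2 / (2 * (\<theta> - 1)))"
    using sub_x super_y drift ham perturb[OF err(4,6)] perturb[OF err(5,7)]
    unfolding p_def[symmetric] q_def[symmetric] right_diff_distrib[of "inverse \<alpha>"] distrib_left
    by linarith
  then have "\<theta> * (fsub x - h x) - (fsuper y - h y) \<le> \<alpha> * (\<delta> * (4 + T0 + T0\<^sup>2 / (2 * (\<theta> - 1))))"
    using \<alpha> by (simp add: field_simps)
  also have "\<dots> = \<delta> * Y - 5 * \<delta>" by (simp add: Y_def algebra_simps)
  finally have upper: "\<theta> * (fsub x - h x) - (fsuper y - h y) \<le> gap / 4 - 5 * \<delta>"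
    using \<delta>Y by linarith
  have "dist x y < d"
  proof -
    have "48 / b < d\<^sup>2" using bd d(1) b1 by (simp add: field_simps)
    then have "(norm (x - y))\<^sup>2 < d\<^sup>2" using err(3) by linarith
    then show ?thesis using d(1) by (simp add: dist_norm power_less_imp_less_base)
  qed
  then have "\<bar>h x - h y\<bar> < gap / 8" using d(2) by (simp add: dist_real_def)
  moreover have "(\<theta> - 1) * h x \<le> (\<theta> - 1) * K"
    using K(4)[of x] \<theta> by (intro mult_left_mono) auto
  moreover have "- ((\<theta> - 1) * fsub z) \<le> (\<theta> - 1) * K"
    using K(2)[of z] \<theta> mult_left_mono[of "- fsub z" K "\<theta> - 1"] by simp
  ultimately show False
    using upper val \<theta>K \<delta>(1) gap unfolding gap_def by (simp add: algebra_simps)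
qed

end
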